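(* Suppose the random vector $X$ in $\mathbb{R}^k$ satisfies the LiNGAM assumption with two parameter sets, that is $$\Theta^{(1)}X+Z^{(1)}\;=\;X\;=\;\Theta^{(2)}X+Z^{(2)},$$ where, for $i=1,2$: $\Theta^{(i)}\in\mathbb{R}^{k\times k}$ is acyclic; the components of the random vector $Z^{(i)}\in\mathbb{R}^k$ are mutually independent and almost surely non-constant; and at most one component $Z^{(i)}_j$ is Gaussian. Then $$\Theta^{(1)}=\Theta^{(2)},\qquad Z^{(1)}=Z^{(2)}\ \text{ almost surely}.$$
   Context: A matrix $\Theta\in\mathbb{R}^{k\times k}$ is called acyclic if there is a bijection $\pi:\{1,\dots,k\}\to\{1,\dots,k\}$ (a causal order) such that $\Theta_{ab}=0$ whenever $\pi(a)\le\pi(b)$; equivalently, $\Theta$ becomes strictly lower triangular after simultaneously permuting rows and columns by $\pi$. The two matrices may have different causal orders. Almost surely non-constant means the law is not a Dirac measure. *)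

theory Defs
  imports "HOL-Probability.Probability"
begin

definition causal_order :: "real^'k^'k \<Rightarrow> ('k::finite \<Rightarrow> nat) \<Rightarrow> bool" where
  "causal_order \<Theta> \<pi> \<longleftrightarrow>
     bij_betw \<pi> UNIV {1..CARD('k)} \<and> (\<forall>a b. \<pi> a \<le> \<pi> b \<longrightarrow> \<Theta> $ a $ b = 0)"

definition acyclic_matrix :: "real^'k^'k \<Rightarrow> bool" where
  "acyclic_matrix \<Theta> \<longleftrightarrow> (\<exists>\<pi>. causal_order \<Theta> \<pi>)"

definition as_nonconstant :: "'a measure \<Rightarrow> ('a \<Rightarrow> real) \<Rightarrow> bool" where
  "as_nonconstant M Y \<longleftrightarrow> \<not> (\<exists>c. distr M borel Y = return borel c)"

text \<open>Degenerate (zero variance) Gaussians are not included; below, Gaussianity is only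
  considered for almost surely non-constant random variables.\<close>

definition gaussian :: "'a measure \<Rightarrow> ('a \<Rightarrow> real) \<Rightarrow> bool" where
  "gaussian M Y \<longleftrightarrow> (\<exists>\<mu> \<sigma>. \<sigma> > 0 \<and> distributed M lborel Y (normal_density \<mu> \<sigma>))"

text \<open>Equality of random vectors in the model equation is understood almost surely.\<close>

definition lingam :: "'a measure \<Rightarrow> ('a \<Rightarrow> real^'k) \<Rightarrow> real^'k^'k \<Rightarrow> ('a \<Rightarrow> real^'k) \<Rightarrow> bool" where
  "lingam M X \<Theta> Z \<longleftrightarrow>
     acyclic_matrix \<Theta> \<and>
     X \<in> borel_measurable M \<and>
     Z \<in> borel_measurable M \<and>
     (AE \<omega> in M. X \<omega> = \<Theta> *v X \<omega> + Z \<omega>) \<and>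
     prob_space.indep_vars M (\<lambda>_. borel) (\<lambda>j \<omega>. Z \<omega> $ j) UNIV \<and>
     (\<forall>j. as_nonconstant M (\<lambda>\<omega>. Z \<omega> $ j)) \<and>
     card {j. gaussian M (\<lambda>\<omega>. Z \<omega> $ j)} \<le> 1"

end

theory Submission
  imports Defs "HOL-Complex_Analysis.Conformal_Mappings"
begin

text \<open>Since \<open>Z1 = (I - \<Theta>1) X\<close> and \<open>Z2 = (I - \<Theta>2) X\<close> almost surely, the two noise vectors are related by
\<open>Z2 = B Z1\<close> with \<open>B = (I - \<Theta>2) (I - \<Theta>1)\<inverse>\<close>. The whole probabilistic content is that every column of
\<open>B\<close> has at most one nonzero entry (\<open>independent_mixing_columns\<close>); the rest is linear algebra.
If \<open>B\<close> has such columns, then every row of \<open>I - \<Theta>2\<close> is a multiple of a row \<open>\<sigma>(i)\<close> of \<open>I - \<Theta>1\<close>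
for a permutation \<open>\<sigma>\<close>. The diagonal of \<open>I - \<Theta>2\<close> consists of ones, so acyclicity of \<open>\<Theta>1\<close> forces
\<open>\<sigma>\<close> never to move an index down in the causal order of \<open>\<Theta>1\<close>. A permutation of a finite set with this
property is the identity, and comparing diagonals gives \<open>\<Theta>1 = \<Theta>2\<close> (\<open>acyclic_row_permutation_eq\<close>).

Suppose a column of \<open>B\<close> had two nonzero entries, in rows \<open>a\<close> and \<open>b\<close>. Then the independent variables
\<open>(B Z1)\<^sub>a\<close> and \<open>(B Z1)\<^sub>b\<close> are linear combinations of independent summands that share at least one summand. By the
Darmois--Skitovich theorem (\<open>darmois_skitovich\<close>) every shared summand is Gaussian; as there is at most
one Gaussian component, exactly one summand is shared. But if a single summand is shared, its
characteristic function has modulus one near the origin and it is constant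
(\<open>single_common_summand_imp_return\<close>), which is excluded.

For the Darmois--Skitovich theorem, independence of the
two linear forms is a functional equation for characteristic functions. Taking logarithms of their moduli
near the origin turns it into an identity \<open>\<Sum>c. \<psi>\<^sub>c (s + c t) = A s + B t\<close> between ridge functions, and
repeated differencing shows that each \<open>\<psi>\<^sub>c\<close> with \<open>c \<noteq> 0\<close> is a polynomial near the origin
(\<open>ridge_sum_polynomial\<close>). Working with moduli means working with symmetrised variables and avoids
complex logarithms. So each shared summand is an independent summand of a variable whose characteristic
function is the exponential of a polynomial near the origin.

Such a summand is Gaussian or constant (\<open>cramer_marcinkiewicz\<close>, a common generalisation of the theorems
of Cramer and of Marcinkiewicz). The local formula bounds all even moments of the sum, hence its
exponential moments and those of its summands. Both summands therefore have entire moment generating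
functions, whose product is the exponential of a polynomial on the whole plane. They have no zeros, and
they grow at most like the exponential of a polynomial, so by Borel--Caratheodory and Liouville the
logarithm \<open>g\<close> of such a function is a polynomial. Finally \<open>\<bar>E exp (z X)\<bar> \<le> E exp (Re z X)\<close>
says \<open>Re (g z) \<le> Re (g (Re z))\<close>, and this is impossible for a polynomial of degree greater than two.\<close>

section \<open>Ridge functions and finite differences\<close>

definition fdiff :: "real \<Rightarrow> (real \<Rightarrow> real) \<Rightarrow> real \<Rightarrow> real" where
  "fdiff h f x = f (x + h) - f x"

lemma newton_forward:
  "f (x + real k * h) = (\<Sum>i\<le>k. real (k choose i) * (fdiff h ^^ i) f x)"
proof (induction k arbitrary: f)
  case 0
  show ?case by simp
next
  case (Suc k)
  have "f (x + real (Suc k) * h) = f (x + real k * h) + fdiff h f (x + real k * h)"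
    by (simp add: fdiff_def algebra_simps)
  also have "\<dots> = (\<Sum>i\<le>k. real (k choose i) * (fdiff h ^^ i) f x)
      + (\<Sum>i\<le>k. real (k choose i) * (fdiff h ^^ Suc i) f x)"
    by (simp only: Suc.IH funpow_Suc_right o_apply)
  also have "(\<Sum>i\<le>k. real (k choose i) * (fdiff h ^^ i) f x)
      = f x + (\<Sum>i\<le>k. real (k choose Suc i) * (fdiff h ^^ Suc i) f x)"
    using sum.atMost_Suc_shift[of "\<lambda>i. real (k choose i) * (fdiff h ^^ i) f x" k]
    by (simp add: binomial_eq_0)
  finally show ?case
    by (simp add: sum.atMost_Suc_shift sum.distrib algebra_simps del: sum.atMost_Suc)
qed

text \<open>A difference of order \<open>j\<close> only looks at \<open>j + 1\<close> consecutive grid points. Applied to \<open>g = \<Delta>\<^sup>N f\<close>, this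
passes from vanishing differences of order \<open>N\<close> to all higher orders, with control over the points used.\<close>

lemma fdiff_funpow_zero:
  assumes "\<And>i. i \<le> j \<Longrightarrow> g (x + real i * h) = 0"
  shows "(fdiff h ^^ j) g x = 0"
  using assms
proof (induction j arbitrary: x)
  case 0
  from 0[of 0] show ?case by simp
next
  case (Suc j)
  have "(fdiff h ^^ j) g x = 0"
    by (rule Suc.IH) (use Suc.prems in auto)
  moreover have "(fdiff h ^^ j) g (x + h) = 0"
  proof (rule Suc.IH)
    fix i assume "i \<le> j"
    then show "g (x + h + real i * h) = 0"
      using Suc.prems[of "Suc i"] by (simp add: algebra_simps)
  qed
  ultimately show ?case
    using fdiff_def[of h "(fdiff h ^^ j) g" x] by simp
qed

text \<open>Newton's interpolation polynomial for the nodes \<open>a, a + h, a + 2 h, \<dots>\<close>, truncated below degree \<open>N\<close>.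
The product is the falling factorial of \<open>(x - a) / h\<close>.\<close>

definition newton_poly :: "nat \<Rightarrow> real \<Rightarrow> (real \<Rightarrow> real) \<Rightarrow> real \<Rightarrow> real poly" where
  "newton_poly N h f a =
     (\<Sum>i<N. smult ((fdiff h ^^ i) f a / fact i) (\<Prod>j<i. [:- real j - a / h, 1 / h:]))"

lemma degree_newton_poly: "degree (newton_poly N h f a) \<le> N"
  unfolding newton_poly_def
proof (rule degree_sum_le)
  fix i assume i: "i \<in> {..<N}"
  have "degree (\<Prod>j<i. [:- real j - a / h, 1 / h:]) \<le> sum (degree \<circ> (\<lambda>j. [:- real j - a / h, 1 / h:])) {..<i}"
    by (rule degree_prod_sum_le) simp
  also have "\<dots> \<le> sum (\<lambda>_. 1) {..<i}" by (rule sum_mono) simp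
  also have "\<dots> \<le> N" using i by simp
  finally show "degree (smult ((fdiff h ^^ i) f a / fact i) (\<Prod>j<i. [:- real j - a / h, 1 / h:])) \<le> N"
    by (meson degree_smult_le le_trans)
qed simp

lemma newton_poly_interpolates:
  assumes "h \<noteq> 0" and van: "\<And>j. j + N \<le> k \<Longrightarrow> (fdiff h ^^ N) f (a + real j * h) = 0"
  shows "f (a + real k * h) = poly (newton_poly N h f a) (a + real k * h)"
proof -
  have ch: "real (k choose i) = (\<Prod>j<i. real k - real j) / fact i" for i
    by (simp add: binomial_gbinomial gbinomial_prod_rev atLeast0LessThan)
  have vanish: "(fdiff h ^^ i) f a = 0" if "N \<le> i" "i \<le> k" for i
  proof -
    have "(fdiff h ^^ (i - N)) ((fdiff h ^^ N) f) a = 0"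
      by (rule fdiff_funpow_zero) (use van that in auto)
    moreover have "(fdiff h ^^ (i - N)) ((fdiff h ^^ N) f) = (fdiff h ^^ i) f"
      using that by (metis comp_apply funpow_add le_add_diff_inverse2)
    ultimately show ?thesis by simp
  qed
  have "f (a + real k * h) = (\<Sum>i\<le>k. real (k choose i) * (fdiff h ^^ i) f a)"
    by (rule newton_forward)
  also have "\<dots> = (\<Sum>i<N. real (k choose i) * (fdiff h ^^ i) f a)"
  proof (cases "N \<le> k")
    case True
    then show ?thesis
      by (intro sum.mono_neutral_right) (auto simp: vanish)
  next
    case False
    then show ?thesis by (intro sum.mono_neutral_left) auto
  qed
  also have "\<dots> = poly (newton_poly N h f a) (a + real k * h)"
    unfolding newton_poly_def poly_sum
  proof (rule sum.cong)
    fix i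
    have "poly (\<Prod>j<i. [:- real j - a / h, 1 / h:]) (a + real k * h) = (\<Prod>j<i. real k - real j)"
      unfolding poly_prod using \<open>h \<noteq> 0\<close> by (intro prod.cong) (auto simp: field_simps)
    then show "real (k choose i) * (fdiff h ^^ i) f a =
      poly (smult ((fdiff h ^^ i) f a / fact i) (\<Prod>j<i. [:- real j - a / h, 1 / h:])) (a + real k * h)"
      by (simp add: ch)
  qed simp
  finally show ?thesis .
qed

lemma poly_eqI_many_points:
  fixes p q :: "real poly"
  assumes "finite S" "degree p < card S" "degree q < card S" "\<And>x. x \<in> S \<Longrightarrow> poly p x = poly q x"
  shows "p = q"
proof (rule ccontr)
  assume "p \<noteq> q"
  then have ne: "p - q \<noteq> 0" by simp
  have "card S \<le> card {x. poly (p - q) x = 0}"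
    by (rule card_mono[OF poly_roots_finite[OF ne]]) (use assms in auto)
  also have "\<dots> \<le> degree (p - q)" by (rule card_poly_roots_bound[OF ne])
  also have "\<dots> < card S" using assms degree_diff_less by blast
  finally show False by simp
qed

text \<open>The case of equal increments of Frechet's characterisation of polynomials. On each dyadic grid the Newton
polynomial interpolates \<open>f\<close>; a finer grid contains the coarser one, and once there are more than \<open>N\<close>
grid points the two polynomials must coincide. So one polynomial agrees with \<open>f\<close> on all dyadic points,
and by continuity everywhere.\<close>

lemma polynomial_of_vanishing_differences:
  fixes f :: "real \<Rightarrow> real"
  assumes cont: "continuous_on {a..b} f" and ab: "a < b"
    and van: "\<And>u h. h > 0 \<Longrightarrow> a \<le> u \<Longrightarrow> u + real N * h \<le> b \<Longrightarrow> (fdiff h ^^ N) f u = 0"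
  shows "\<exists>p. \<forall>x\<in>{a..b}. f x = poly p x"
proof -
  define h where "h m = (b - a) / 2 ^ m" for m :: nat
  have h_pos: "h m > 0" for m using ab by (simp add: h_def)
  define P where "P m = newton_poly N (h m) f a" for m
  have in_range: "a + real k * h m \<le> b" if "k \<le> 2 ^ m" for k m
  proof -
    have "real k * h m \<le> 2 ^ m * h m"
      using that h_pos[of m] by (intro mult_right_mono) (auto simp: of_nat_le_iff[symmetric] simp del: of_nat_le_iff)
    then show ?thesis by (simp add: h_def)
  qed
  have interp: "f (a + real k * h m) = poly (P m) (a + real k * h m)" if "k \<le> 2 ^ m" for k m
    unfolding P_def
  proof (rule newton_poly_interpolates)
    show "h m \<noteq> 0" using h_pos[of m] by simp
    fix j assume "j + N \<le> k"
    then have "a + real (j + N) * h m \<le> b" using that by (intro in_range) simp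
    then show "(fdiff (h m) ^^ N) f (a + real j * h m) = 0"
      using h_pos[of m] by (intro van) (auto simp: algebra_simps)
  qed
  have step: "P (Suc m) = P m" if "m \<ge> N" for m
  proof (rule poly_eqI_many_points)
    let ?S = "(\<lambda>k. a + real k * h m) ` {..2 ^ m}"
    have "card ?S = 2 ^ m + 1"
      using h_pos[of m] by (subst card_image) (auto simp: inj_on_def)
    moreover have "N < 2 ^ m + 1"
      using that less_exp[of m] by linarith
    ultimately show "degree (P (Suc m)) < card ?S" "degree (P m) < card ?S"
      using degree_newton_poly[of N] unfolding P_def by (metis le_less_trans)+
    fix x assume "x \<in> ?S"
    then obtain k where k: "k \<le> 2 ^ m" "x = a + real k * h m" by auto
    have x2: "x = a + real (2 * k) * h (Suc m)" using k by (simp add: h_def)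
    show "poly (P (Suc m)) x = poly (P m) x"
      using interp[of k m] interp[of "2 * k" "Suc m"] k(1) unfolding k(2)[symmetric] x2[symmetric]
      by simp
  qed simp
  have P_const: "P m = P N" if "m \<ge> N" for m
    using that by (induction m rule: dec_induct) (simp_all add: step)
  have "f x = poly (P N) x" if x: "x \<in> {a..b}" for x
  proof -
    define k where "k m = nat \<lfloor>(x - a) / h m\<rfloor>" for m
    define X where "X m = a + real (k m) * h m" for m
    have k_le: "real (k m) \<le> (x - a) / h m" and k_ge: "(x - a) / h m < real (k m) + 1" for m
      using x h_pos[of m] by (auto simp: k_def intro: floor_correct)
    have X_le: "X m \<le> x" and X_ge: "x - h m \<le> X m" for m
      using k_le[of m] k_ge[of m] h_pos[of m] by (auto simp: X_def field_simps)
    have k_bd: "k m \<le> 2 ^ m" for m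
    proof -
      have "(x - a) / h m \<le> (b - a) / h m"
        using x h_pos[of m] by (intro divide_right_mono) auto
      also have "\<dots> = 2 ^ m" using ab by (simp add: h_def)
      finally have "real (k m) \<le> 2 ^ m" using k_le[of m] by (rule order_trans[rotated])
      then show ?thesis using of_nat_le_iff[of "k m" "2 ^ m", where 'a = real] by simp
    qed
    have h_lim: "h \<longlonglongrightarrow> 0"
      unfolding h_def by (intro tendsto_divide_0[OF tendsto_const] filterlim_realpow_sequentially_gt1) 
         (auto intro: filterlim_at_top_imp_at_infinity)
    have X_lim: "X \<longlonglongrightarrow> x"
    proof (rule tendsto_sandwich)
      show "(\<lambda>m. x - h m) \<longlonglongrightarrow> x" using tendsto_diff[OF tendsto_const h_lim, of x] by simp
    qed (use X_le X_ge in auto)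
    have X_in: "X m \<in> {a..b}" for m
      using in_range[OF k_bd] h_pos[of m] by (auto simp: X_def)
    have "(\<lambda>m. f (X m)) \<longlonglongrightarrow> f x"
      using continuous_on_tendsto_compose[OF cont X_lim x] X_in by simp
    moreover have "\<forall>\<^sub>F m in sequentially. f (X m) = poly (P N) (X m)"
      using eventually_ge_at_top[of N]
    proof eventually_elim
      case (elim m)
      then show ?case using interp[OF k_bd, of m] P_const[of m] by (simp add: X_def)
    qed
    ultimately have "(\<lambda>m. poly (P N) (X m)) \<longlonglongrightarrow> f x"
      by (rule Lim_transform_eventually)
    moreover have "(\<lambda>m. poly (P N) (X m)) \<longlonglongrightarrow> poly (P N) x"
      by (intro tendsto_poly X_lim)
    ultimately show ?thesis using LIMSEQ_unique by blast
  qed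
  then show ?thesis by blast
qed

text \<open>Moving \<open>(s, t)\<close> along the direction \<open>(-c1, 1)\<close> leaves \<open>s + c1 * t\<close> unchanged. Hence differencing the
identity in that direction removes the term \<open>\<psi> c1\<close>, replaces the other \<open>\<psi> c\<close> by differences, and keeps the
right-hand side of the form \<open>A s + B t\<close>. The length of the step is chosen such that \<open>\<psi> c0\<close> is
always differenced with increment exactly \<open>h\<close>. The two last differences, along the two axes,
remove \<open>A\<close> and \<open>B\<close>. The constant \<open>K\<close> bounds how much room one step uses up; it has to be the same for all
\<open>h\<close>, which is why the range of validity \<open>\<delta>\<close> is tracked explicitly.\<close>

lemma fdiff_vanish_of_ridge_sum:
  fixes \<psi> :: "real \<Rightarrow> real \<Rightarrow> real"
  assumes "finite D" "c0 \<notin> D" "c0 \<noteq> 0"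
    and K: "1 \<le> K" "1 \<le> K * \<bar>c0\<bar>" "\<And>c. c \<in> D \<Longrightarrow> 1 + \<bar>c\<bar> \<le> K * \<bar>c0 - c\<bar>"
    and eq: "\<And>s t. \<bar>s\<bar> \<le> \<delta> \<Longrightarrow> \<bar>t\<bar> \<le> \<delta> \<Longrightarrow> (\<Sum>c\<in>insert c0 D. \<psi> c (s + c * t)) = A s + B t"
    and u: "\<bar>u\<bar> + real (card D + 1) * K * \<bar>h\<bar> \<le> \<delta>"
  shows "(fdiff h ^^ (card D + 2)) (\<psi> c0) u = 0"
  using assms(1,2) K(3) eq u
proof (induction D arbitrary: \<psi> A B \<delta> rule: finite_induct)
  case empty
  define v where "v = h / c0"
  have v: "c0 * v = h" using \<open>c0 \<noteq> 0\<close> by (simp add: v_def)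
  have "\<bar>v\<bar> \<le> K * \<bar>h\<bar>"
    using K \<open>c0 \<noteq> 0\<close> mult_right_mono[OF K(2), of "\<bar>h\<bar>"]
    by (simp add: v_def abs_divide divide_simps mult_ac)
  moreover have "\<bar>h\<bar> \<le> K * \<bar>h\<bar>" using K(1) mult_right_mono[of 1 K "\<bar>h\<bar>"] by simp
  moreover have "\<bar>u\<bar> + K * \<bar>h\<bar> \<le> \<delta>" using empty by simp
  ultimately have b: "\<bar>u\<bar> \<le> \<delta>" "\<bar>u + h\<bar> \<le> \<delta>" "\<bar>v\<bar> \<le> \<delta>" "\<bar>0\<bar> \<le> \<delta>" by linarith+
  have e: "\<psi> c0 (s + c0 * t) = A s + B t" if "\<bar>s\<bar> \<le> \<delta>" "\<bar>t\<bar> \<le> \<delta>" for s t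
    using empty.prems(3)[OF that] by simp
  show ?case
    using e[OF b(1) b(4)] e[OF b(1) b(3)] e[OF b(2) b(4)] e[OF b(2) b(3)]
    by (simp add: fdiff_def v numeral_2_eq_2)
next
  case (insert c1 D)
  define k where "k = h / (c0 - c1)"
  have ne: "c0 \<noteq> c1" using insert by auto
  then have k: "(c0 - c1) * k = h" by (simp add: k_def)
  have "(1 + \<bar>c1\<bar>) * \<bar>k\<bar> \<le> K * \<bar>c0 - c1\<bar> * \<bar>k\<bar>"
    using insert.prems(2)[of c1] by (intro mult_right_mono) auto
  also have "\<dots> = K * \<bar>h\<bar>" using k by (metis abs_mult mult.assoc)
  finally have kb: "\<bar>k\<bar> + \<bar>c1 * k\<bar> \<le> K * \<bar>h\<bar>" by (simp add: abs_mult algebra_simps)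
  define \<psi>' where "\<psi>' c x = \<psi> c (x + (c - c1) * k) - \<psi> c x" for c x
  have "(fdiff h ^^ (card D + 2)) (\<psi>' c0) u = 0"
  proof (rule insert.IH)
    show "c0 \<notin> D" using insert by auto
    show "1 + \<bar>c\<bar> \<le> K * \<bar>c0 - c\<bar>" if "c \<in> D" for c using insert.prems that by auto
    show "\<bar>u\<bar> + real (card D + 1) * K * \<bar>h\<bar> \<le> \<delta> - K * \<bar>h\<bar>"
      using insert by (simp add: algebra_simps)
    fix s t assume st: "\<bar>s\<bar> \<le> \<delta> - K * \<bar>h\<bar>" "\<bar>t\<bar> \<le> \<delta> - K * \<bar>h\<bar>"
    have "(\<Sum>c\<in>insert c0 D. \<psi>' c (s + c * t)) = (\<Sum>c\<in>insert c0 (insert c1 D). \<psi>' c (s + c * t))"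
      using insert by (intro sum.mono_neutral_left) (auto simp: \<psi>'_def)
    also have "\<dots> = (\<Sum>c\<in>insert c0 (insert c1 D). \<psi> c ((s - c1 * k) + c * (t + k)))
        - (\<Sum>c\<in>insert c0 (insert c1 D). \<psi> c (s + c * t))"
      by (simp only: \<psi>'_def sum_subtractf) (simp add: algebra_simps)
    also have "\<dots> = (A (s - c1 * k) + B (t + k)) - (A s + B t)"
    proof -
      have "\<bar>s - c1 * k\<bar> \<le> \<delta>" "\<bar>t + k\<bar> \<le> \<delta>" "\<bar>s\<bar> \<le> \<delta>" "\<bar>t\<bar> \<le> \<delta>" using st kb by linarith+
      then show ?thesis using insert.prems(3) by presburger
    qed
    finally show "(\<Sum>c\<in>insert c0 D. \<psi>' c (s + c * t)) = (A (s - c1 * k) - A s) + (B (t + k) - B t)"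
      by simp
  qed
  moreover have "\<psi>' c0 = fdiff h (\<psi> c0)" by (auto simp: \<psi>'_def fdiff_def k)
  moreover have "card (insert c1 D) + 2 = Suc (card D + 2)" using insert by simp
  ultimately show ?case by (simp only: funpow_Suc_right o_apply)
qed

lemma ridge_sum_polynomial:
  fixes \<psi> :: "real \<Rightarrow> real \<Rightarrow> real"
  assumes "finite C" "c0 \<in> C" "c0 \<noteq> 0" "0 < \<delta>"
    and eq: "\<And>s t. \<bar>s\<bar> \<le> \<delta> \<Longrightarrow> \<bar>t\<bar> \<le> \<delta> \<Longrightarrow> (\<Sum>c\<in>C. \<psi> c (s + c * t)) = A s + B t"
    and cont: "continuous_on {-\<delta>..\<delta>} (\<psi> c0)"
  shows "\<exists>p. \<exists>\<epsilon>>0. \<forall>u. \<bar>u\<bar> \<le> \<epsilon> \<longrightarrow> \<psi> c0 u = poly p u"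
proof -
  define D where "D = C - {c0}"
  have D: "finite D" "c0 \<notin> D" "insert c0 D = C" using assms by (auto simp: D_def)
  define K where "K = 1 + 1 / \<bar>c0\<bar> + (\<Sum>c\<in>D. (1 + \<bar>c\<bar>) / \<bar>c0 - c\<bar>)"
  have sum_nn: "(\<Sum>c\<in>D. (1 + \<bar>c\<bar>) / \<bar>c0 - c\<bar>) \<ge> 0" by (intro sum_nonneg) simp
  have K1: "1 \<le> K" using sum_nn by (simp add: K_def)
  have "1 / \<bar>c0\<bar> \<le> K" using sum_nn by (simp add: K_def)
  then have K2: "1 \<le> K * \<bar>c0\<bar>" using \<open>c0 \<noteq> 0\<close> by (simp add: field_simps)
  have K3: "1 + \<bar>c\<bar> \<le> K * \<bar>c0 - c\<bar>" if "c \<in> D" for c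
  proof -
    have "(1 + \<bar>c\<bar>) / \<bar>c0 - c\<bar> \<le> (\<Sum>c\<in>D. (1 + \<bar>c\<bar>) / \<bar>c0 - c\<bar>)"
      using D that by (intro member_le_sum) auto
    also have "\<dots> \<le> K" by (simp add: K_def)
    finally show ?thesis using that D by (subst (asm) pos_divide_le_eq) auto
  qed
  define \<epsilon> where "\<epsilon> = \<delta> / (1 + real (card D + 1) * K)"
  have den: "1 + real (card D + 1) * K \<ge> 1" using K1 by simp
  have \<epsilon>: "\<epsilon> > 0" "\<epsilon> \<le> \<delta>" "\<epsilon> * (1 + real (card D + 1) * K) = \<delta>"
    using den \<open>0 < \<delta>\<close> by (auto simp: \<epsilon>_def divide_simps)
  have "\<exists>p. \<forall>x\<in>{-\<epsilon>..\<epsilon>}. \<psi> c0 x = poly p x"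
  proof (rule polynomial_of_vanishing_differences)
    show "continuous_on {-\<epsilon>..\<epsilon>} (\<psi> c0)"
      using cont by (rule continuous_on_subset) (use \<epsilon> in auto)
    show "-\<epsilon> < \<epsilon>" using \<epsilon> by simp
    fix u h :: real
    assume h: "h > 0" "-\<epsilon> \<le> u" "u + real (card D + 2) * h \<le> \<epsilon>"
    have "0 \<le> real (card D) * h" using h by simp
    moreover have "u + real (card D) * h + 2 * h \<le> \<epsilon>" using h(3) by (simp add: algebra_simps)
    ultimately have hu: "h \<le> \<epsilon>" "\<bar>u\<bar> \<le> \<epsilon>" using h(1,2) by linarith+
    show "(fdiff h ^^ (card D + 2)) (\<psi> c0) u = 0"
    proof (rule fdiff_vanish_of_ridge_sum[OF D(1,2) \<open>c0 \<noteq> 0\<close> K1 K2 K3])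
      show "(\<Sum>c\<in>insert c0 D. \<psi> c (s + c * t)) = A s + B t" if "\<bar>s\<bar> \<le> \<delta>" "\<bar>t\<bar> \<le> \<delta>" for s t
        using eq[OF that] D by simp
      have "real (card D + 1) * K * \<bar>h\<bar> \<le> real (card D + 1) * K * \<epsilon>"
        using h hu K1 by (intro mult_left_mono) auto
      then show "\<bar>u\<bar> + real (card D + 1) * K * \<bar>h\<bar> \<le> \<delta>"
        using \<epsilon>(3) hu by (simp add: algebra_simps)
    qed
  qed
  then show ?thesis using \<epsilon>(1) by (metis abs_le_iff atLeastAtMost_iff minus_le_iff)
qed

section \<open>Entire functions whose real part has polynomial growth\<close>

text \<open>The Borel--Caratheodory inequality at half the radius: the map \<open>v \<mapsto> v / (2 A - v)\<close> sends the half plane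
\<open>Re v < A\<close> into the unit disc and fixes the origin, so the Schwarz lemma applies.\<close>

lemma borel_caratheodory_half:
  assumes hol: "g holomorphic_on UNIV" and g0: "g 0 = (0::complex)" and A: "A > 0"
    and Re_less: "\<And>w. norm w < 2 * r \<Longrightarrow> Re (g w) < A" and z: "norm z \<le> r" and r: "r > 0"
  shows "norm (g z) \<le> 2 * A"
proof -
  define \<phi> where "\<phi> w = g (of_real (2 * r) * w) / (2 * of_real A - g (of_real (2 * r) * w))" for w
  have Re_in: "Re (g (of_real (2 * r) * w)) < A" if "norm w < 1" for w
    using that r by (intro Re_less) (simp add: norm_mult)
  \<comment> \<open>The points of the half plane are closer to the origin than to its mirror image in the boundary.\<close>
  have less: "norm v < norm (2 * of_real A - v)" if "Re v < A" for v :: complex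
  proof -
    have "(norm v)\<^sup>2 < (norm (2 * A - v))\<^sup>2"
      unfolding cmod_power2 using mult_strict_left_mono[OF that A] by (simp add: power2_eq_square algebra_simps)
    then show ?thesis by (simp add: power2_less_imp_less)
  qed
  have nz: "2 * of_real A - v \<noteq> 0" if "Re v < A" for v :: complex using less[OF that] by auto
  have den: "2 * of_real A - g (of_real (2 * r) * w) \<noteq> 0" if "norm w < 1" for w
    using nz[OF Re_in[OF that]] .
  have "norm (\<phi> (z / of_real (2 * r))) \<le> norm (z / of_real (2 * r))"
  proof (rule Schwarz_Lemma(1))
    show "\<phi> holomorphic_on ball 0 1"
      unfolding \<phi>_def
    proof (rule holomorphic_on_divide)
      show g_scaled: "(\<lambda>w. g (of_real (2 * r) * w)) holomorphic_on ball 0 1"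
        by (rule holomorphic_on_compose_gen[OF _ hol, unfolded o_def]) (auto intro!: holomorphic_intros)
      show "(\<lambda>w. 2 * of_real A - g (of_real (2 * r) * w)) holomorphic_on ball 0 1"
        by (intro holomorphic_on_diff holomorphic_on_const g_scaled)
      show "2 * of_real A - g (of_real (2 * r) * w) \<noteq> 0" if "w \<in> ball 0 1" for w
        by (rule den) (use that in simp)
    qed
    show "\<phi> 0 = 0" by (simp add: \<phi>_def g0)
    show "norm (\<phi> w) < 1" if "norm w < 1" for w
      using less[OF Re_in[OF that]] by (auto simp: \<phi>_def norm_divide divide_simps)
    show "norm (z / of_real (2 * r)) < 1" using z r by (simp add: norm_divide)
  qed
  also have "\<dots> \<le> 1 / 2" using z r by (simp add: norm_divide)
  finally have "norm (g z / (2 * of_real A - g z)) \<le> 1 / 2" using r by (simp add: \<phi>_def)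
  moreover have "Re (g z) < A" using z r by (intro Re_less) simp
  ultimately have "2 * norm (g z) \<le> norm (2 * of_real A - g z)"
    using nz by (simp add: norm_divide divide_simps)
  also have "\<dots> \<le> 2 * A + norm (g z)"
    using norm_triangle_ineq4[of "2 * complex_of_real A" "g z"] A by (simp add: norm_mult)
  finally show ?thesis by simp
qed

text \<open>Borel--Caratheodory turns the one-sided bound on \<open>Re g\<close> into a bound on \<open>\<bar>g\<bar>\<close>, to which Liouville's
theorem for polynomial growth applies.\<close>

lemma entire_polynomial_of_Re_bound:
  assumes hol: "g holomorphic_on UNIV" and g0: "g 0 = (0::complex)" and K: "K \<ge> 0"
    and Re_le: "\<And>z. Re (g z) \<le> K * (1 + norm z) ^ m"
  shows "\<exists>p. \<forall>z. g z = poly p z"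
proof -
  define B where "B = 2 * (K * 3 ^ m + 1)"
  have "norm (g z) \<le> B * norm z ^ m" if "1 \<le> norm z" for z
  proof -
    have "norm (g z) \<le> 2 * (K * (1 + 2 * norm z) ^ m + 1)"
    proof (rule borel_caratheodory_half[OF hol g0])
      show "0 < K * (1 + 2 * cmod z) ^ m + 1" using K by (intro add_nonneg_pos) auto
      fix w :: complex assume "norm w < 2 * norm z"
      then have "K * (1 + norm w) ^ m \<le> K * (1 + 2 * norm z) ^ m"
        using K by (intro mult_left_mono power_mono) auto
      then show "Re (g w) < K * (1 + 2 * norm z) ^ m + 1" using Re_le[of w] by simp
    qed (use that in auto)
    also have "\<dots> \<le> 2 * (K * (3 * norm z) ^ m + norm z ^ m)"
      using that K by (intro mult_left_mono add_mono power_mono one_le_power) auto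
    also have "\<dots> = B * norm z ^ m" by (simp add: B_def power_mult_distrib algebra_simps)
    finally show ?thesis .
  qed
  then have "g z = (\<Sum>k\<le>m. (deriv ^^ k) g 0 / fact k * z ^ k)" for z
    by (rule Liouville_polynomial[OF hol])
  then have "g z = poly (\<Sum>k\<le>m. monom ((deriv ^^ k) g 0 / fact k) k) z" for z
    by (simp add: poly_sum poly_monom)
  then show ?thesis by blast
qed

lemma poly_ray_tendsto:
  fixes p :: "complex poly"
  shows "((\<lambda>r. poly p (of_real r * w) / of_real r ^ degree p) \<longlongrightarrow> lead_coeff p * w ^ degree p) at_top"
proof -
  let ?n = "degree p"
  have "((\<lambda>r::real. \<Sum>i\<le>?n. coeff p i * w ^ i * of_real (r ^ i / r ^ ?n))
      \<longlongrightarrow> (\<Sum>i\<le>?n. coeff p i * w ^ i * of_real (if i = ?n then 1 else 0))) at_top"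
  proof (intro tendsto_sum tendsto_mult tendsto_const tendsto_of_real)
    fix i assume i: "i \<in> {..?n}"
    show "((\<lambda>r::real. r ^ i / r ^ ?n) \<longlongrightarrow> (if i = ?n then 1 else 0)) at_top"
    proof (cases "i = ?n")
      case True
      have "\<forall>\<^sub>F r in at_top. 1 = (r::real) ^ i / r ^ ?n"
        using eventually_gt_at_top[of 0] by eventually_elim (simp add: True)
      then have "((\<lambda>r::real. r ^ i / r ^ ?n) \<longlongrightarrow> 1) at_top"
        by (intro tendsto_eventually) (auto elim: eventually_mono)
      then show ?thesis using True by simp
    next
      case False
      then obtain j where j: "?n = i + Suc j" using i less_imp_Suc_add[of i ?n] by auto
      have "((\<lambda>r::real. inverse (r ^ Suc j)) \<longlongrightarrow> 0) at_top"
        by (intro tendsto_inverse_0_at_top filterlim_pow_at_top filterlim_ident) simp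
      moreover have "\<forall>\<^sub>F r in at_top. inverse ((r::real) ^ Suc j) = r ^ i / r ^ ?n"
        using eventually_gt_at_top[of 0]
        by eventually_elim (simp add: j power_add field_simps)
      ultimately have "((\<lambda>r::real. r ^ i / r ^ ?n) \<longlongrightarrow> 0) at_top"
        by (rule Lim_transform_eventually)
      then show ?thesis using False by simp
    qed
  qed
  also have "(\<Sum>i\<le>?n. coeff p i * w ^ i * of_real (if i = ?n then 1 else 0)) = lead_coeff p * w ^ ?n"
    by (simp add: if_distrib if_distribR sum.delta cong: if_cong)
  also have "(\<lambda>r::real. \<Sum>i\<le>?n. coeff p i * w ^ i * of_real (r ^ i / r ^ ?n))
      = (\<lambda>r. poly p (of_real r * w) / of_real r ^ ?n)"
    by (auto simp: poly_altdef sum_divide_distrib power_mult_distrib mult_ac intro!: sum.cong)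
  finally show ?thesis .
qed

text \<open>A direction in which a monomial \<open>a z\<^sup>n\<close> is real and as large as possible can be chosen off the real axis:
consecutive candidates differ by the angle \<open>2 \<pi> / n < \<pi>\<close>, so they cannot both be real.\<close>

lemma unit_root_direction:
  fixes a :: complex
  assumes "3 \<le> n"
  shows "\<exists>w. norm w = 1 \<and> \<bar>Re w\<bar> < 1 \<and> a * w ^ n = of_real (norm a)"
proof -
  define \<theta> where "\<theta> k = (2 * pi * of_int k - Arg a) / n" for k :: int
  have pow: "a * cis (\<theta> k) ^ n = of_real (norm a)" for k
  proof -
    have "a * cis (\<theta> k) ^ n = rcis (cmod a) (Arg a) * cis (n * \<theta> k)"
      by (simp only: rcis_cmod_Arg Complex.DeMoivre)
    also have "\<dots> = of_real (norm a) * (cis (Arg a) * cis (n * \<theta> k))"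
      by (simp only: rcis_def mult.assoc)
    also have "cis (Arg a) * cis (n * \<theta> k) = cis (2 * pi * of_int k)"
      using assms by (simp add: cis_mult \<theta>_def)
    finally show ?thesis using cis_multiple_2pi[of "of_int k"] by simp
  qed
  have strict: "\<bar>Re (cis x)\<bar> < 1" if "sin x \<noteq> 0" for x
  proof -
    have "0 < (sin x)\<^sup>2" using that by simp
    then have "(cos x)\<^sup>2 < 1" using sin_cos_squared_add[of x] by linarith
    then show ?thesis by (simp add: abs_square_less_1)
  qed
  have "sin (\<theta> 0) \<noteq> 0 \<or> sin (\<theta> 1) \<noteq> 0"
  proof (rule ccontr)
    assume "\<not> ?thesis"
    then have s: "sin (\<theta> 0) = 0" "sin (\<theta> 1) = 0" by auto
    have "\<theta> 1 = \<theta> 0 + 2 * pi / n" by (simp add: \<theta>_def diff_divide_distrib)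
    then have "sin (2 * pi / n) * cos (\<theta> 0) = 0" using s sin_add[of "\<theta> 0" "2 * pi / n"] by auto
    moreover have "cos (\<theta> 0) \<noteq> 0" using s(1) sin_cos_squared_add[of "\<theta> 0"] by auto
    moreover have "0 < sin (2 * pi / n)"
      using assms by (intro sin_gt_zero) (auto simp: field_simps)
    ultimately show False by simp
  qed
  then show ?thesis using pow strict by (metis norm_cis)
qed

text \<open>Suppose the degree \<open>n\<close> is at least three. Along the direction \<open>w\<close> just found, \<open>Re (p (r w))\<close> grows like
\<open>\<bar>a\<bar> r\<^sup>n\<close>, where \<open>a\<close> is the leading coefficient, whereas on the real axis \<open>Re (p (r Re w))\<close> grows at most
like \<open>\<bar>a\<bar> \<bar>Re w\<bar>\<^sup>n r\<^sup>n\<close>, and \<open>\<bar>Re w\<bar> < 1\<close>.\<close>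

lemma ridge_dominated_degree_le_2:
  fixes p :: "complex poly"
  assumes dom: "\<And>z. Re (poly p z) \<le> Re (poly p (of_real (Re z)))"
  shows "degree p \<le> 2"
proof (rule ccontr)
  assume "\<not> ?thesis"
  then have n: "3 \<le> degree p" by simp
  let ?n = "degree p" and ?a = "lead_coeff p"
  obtain w where w: "norm w = 1" "\<bar>Re w\<bar> < 1" "?a * w ^ ?n = of_real (norm ?a)"
    using unit_root_direction[OF n] by blast
  have a: "norm ?a > 0" using n by auto
  have "Re (?a * w ^ ?n) \<le> Re (?a * of_real (Re w) ^ ?n)"
  proof (rule tendsto_le[OF trivial_limit_at_top_linorder])
    show "((\<lambda>r. Re (poly p (of_real r * w) / of_real r ^ ?n)) \<longlongrightarrow> Re (?a * w ^ ?n)) at_top"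
      by (intro tendsto_Re poly_ray_tendsto)
    show "((\<lambda>r. Re (poly p (of_real r * of_real (Re w)) / of_real r ^ ?n))
        \<longlongrightarrow> Re (?a * of_real (Re w) ^ ?n)) at_top"
      by (intro tendsto_Re poly_ray_tendsto)
    show "\<forall>\<^sub>F r in at_top. Re (poly p (of_real r * w) / of_real r ^ ?n)
        \<le> Re (poly p (of_real r * of_real (Re w)) / of_real r ^ ?n)"
      using eventually_gt_at_top[of 0]
    proof eventually_elim
      case (elim r)
      have "Re (poly p (of_real r * w)) \<le> Re (poly p (of_real r * of_real (Re w)))"
        using dom[of "of_real r * w"] by simp
      then show ?case
        using elim unfolding of_real_power[symmetric] Re_divide_of_real
        by (intro divide_right_mono) auto
    qed
  qed
  also have "\<dots> \<le> norm (?a * of_real (Re w) ^ ?n)" by (rule complex_Re_le_cmod)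
  also have "\<dots> = norm ?a * \<bar>Re w\<bar> ^ ?n" by (simp add: norm_mult norm_power)
  also have "\<dots> < norm ?a * 1"
    using a w n by (intro mult_strict_left_mono) (auto simp: power_less_one_iff)
  finally have "Re (of_real (norm ?a)) < norm ?a" unfolding w(3) by simp
  then show False by simp
qed

lemma ridge_dominated_quadratic:
  fixes p :: "complex poly"
  assumes dom: "\<And>z. Re (poly p z) \<le> Re (poly p (of_real (Re z)))" and p0: "poly p 0 = 0"
  shows "\<exists>a d::real. 0 \<le> d \<and> (\<forall>z. poly p z = of_real a * z + of_real d * z\<^sup>2)"
proof -
  define b c where "b = coeff p 1" and "c = coeff p 2"
  have p: "poly p z = b * z + c * z\<^sup>2" for z
  proof -
    have "poly p z = (\<Sum>i\<le>2. coeff p i * z ^ i)"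
      using ridge_dominated_degree_le_2[OF dom] by (auto simp: poly_altdef le_degree intro!: sum.mono_neutral_left)
    then show ?thesis using p0 by (simp add: numeral_2_eq_2 b_def c_def poly_0_coeff_0)
  qed
  have key: "0 \<le> y * (Im b + 2 * Im c * x + Re c * y)" for x y
    using dom[of "Complex x y"] unfolding p by (simp add: power2_eq_square algebra_simps)
  have lin: "Im b + 2 * Im c * x = 0" for x
  proof (rule ccontr)
    let ?e = "Im b + 2 * Im c * x"
    assume ne: "?e \<noteq> 0"
    \<comment> \<open>For small \<open>y\<close> of the sign opposite to the linear coefficient, the linear term outweighs the quadratic one.\<close>
    define C where "C = \<bar>Re c\<bar> + 1"
    have C: "C > 0" "Re c / (2 * C) < 1" by (auto simp: C_def divide_simps)
    define y where "y = - (?e / (2 * C))"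
    have "y * (?e + Re c * y) = - ((?e\<^sup>2 / (2 * C)) * (1 - Re c / (2 * C)))"
      using C(1) by (simp add: y_def power2_eq_square right_diff_distrib)
    moreover have "0 < (?e\<^sup>2 / (2 * C)) * (1 - Re c / (2 * C))"
      using ne C by (intro mult_pos_pos divide_pos_pos) auto
    ultimately show False using key[of y x] by linarith
  qed
  have "Im b = 0" "Im c = 0" using lin[of 0] lin[of 1] by auto
  moreover have "0 \<le> Re c" using key[of 1 0] calculation by simp
  ultimately show ?thesis using p by (intro exI[of _ "Re b"] exI[of _ "Re c"]) (auto simp: complex_eq_iff)
qed

section \<open>Moment bounds from a holomorphic extension of the characteristic function\<close>

text \<open>Centred differences are used because they act on \<open>exp (i t x)\<close> as multiplication by \<open>2 i sin (h x / 2)\<close>, so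
that the differences of even order of a characteristic function at \<open>0\<close> are integrals of a function of constant sign.\<close>

definition cdiff :: "real \<Rightarrow> (complex \<Rightarrow> complex) \<Rightarrow> complex \<Rightarrow> complex" where
  "cdiff h F z = F (z + of_real (h / 2)) - F (z - of_real (h / 2))"

lemma cdiff_funpow_deriv:
  assumes "F holomorphic_on UNIV"
  shows "((cdiff h ^^ n) F has_field_derivative (cdiff h ^^ n) (deriv F) z) (at z)"
proof (induction n arbitrary: z)
  case 0
  show ?case using assms by (simp add: holomorphic_derivI)
next
  case (Suc n)
  have sh: "((\<lambda>z. (cdiff h ^^ n) F (z + c)) has_field_derivative (cdiff h ^^ n) (deriv F) (z + c)) (at z)" for c
    using Suc.IH[of "z + c"] by (simp add: DERIV_shift)
  show ?case
    using DERIV_diff[OF sh[of "of_real (h / 2)"] sh[of "- of_real (h / 2)"]]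
    by (simp add: cdiff_def[abs_def])
qed

lemma norm_cdiff_funpow_le:
  assumes "F holomorphic_on UNIV" "h \<ge> 0"
    and "\<And>w. norm (w - z) \<le> real n * h / 2 \<Longrightarrow> norm ((deriv ^^ n) F w) \<le> B"
  shows "norm ((cdiff h ^^ n) F z) \<le> B * h ^ n"
  using assms
proof (induction n arbitrary: F z)
  case 0
  then show ?case by simp
next
  case (Suc n)
  let ?G = "(cdiff h ^^ n) F" and ?G' = "(cdiff h ^^ n) (deriv F)"
  have hol': "deriv F holomorphic_on UNIV" using Suc.prems by (intro holomorphic_deriv) auto
  have "norm (?G (z + of_real (h / 2)) - ?G (z - of_real (h / 2)))
      \<le> (B * h ^ n) * norm ((z + of_real (h / 2)) - (z - of_real (h / 2)))"
  proof (rule field_differentiable_bound[where S = "cball z (h / 2)"])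
    show "(?G has_field_derivative ?G' w) (at w within cball z (h / 2))" for w
      using cdiff_funpow_deriv[OF Suc.prems(1)] by (rule has_field_derivative_at_within)
    fix w assume "w \<in> cball z (h / 2)"
    then have w: "norm (w - z) \<le> h / 2" by (simp add: dist_norm norm_minus_commute)
    show "norm (?G' w) \<le> B * h ^ n"
    proof (rule Suc.IH[OF hol' Suc.prems(2)])
      fix v assume "norm (v - w) \<le> real n * h / 2"
      then have "norm (v - z) \<le> real (Suc n) * h / 2"
        using norm_triangle_ineq[of "v - w" "w - z"] w by (simp add: field_simps)
      then show "norm ((deriv ^^ n) (deriv F) v) \<le> B"
        using Suc.prems(3) by (simp only: funpow_Suc_right o_apply)
    qed
  qed (use Suc.prems(2) in \<open>auto simp: dist_norm\<close>)
  then show ?case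
    using Suc.prems(2) cdiff_def[of h ?G z] by (simp add: mult_ac)
qed

lemma (in real_distribution) char_central_difference:
  assumes eq: "\<And>s. \<bar>s\<bar> < \<delta> \<Longrightarrow> char M s = F (of_real s)"
    and t: "\<bar>t\<bar> + real n * h / 2 < \<delta>" and h: "h \<ge> 0"
  shows "(cdiff h ^^ n) F (of_real t) = (CLINT x|M. (2 * \<i> * of_real (sin (h * x / 2))) ^ n * iexp (t * x))"
  using t
proof (induction n arbitrary: t)
  case 0
  then show ?case using eq[of t] by (simp add: char_def)
next
  case (Suc n)
  have int: "integrable M (\<lambda>x. (2 * \<i> * of_real (sin (h * x / 2))) ^ n * iexp (s * x))" for s
    by (intro integrable_const_bound[of _ "2 ^ n"])
       (auto simp: norm_mult norm_power power_mult_distrib intro!: mult_left_le power_le_one abs_sin_le_one)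
  have *: "(cdiff h ^^ n) F (of_real (t + c)) = (CLINT x|M. (2 * \<i> * of_real (sin (h * x / 2))) ^ n * iexp ((t + c) * x))"
    if "\<bar>c\<bar> = h / 2" for c
    using Suc.prems that abs_triangle_ineq[of t c]
    by (intro Suc.IH) (simp add: algebra_simps add_divide_distrib)
  have e: "iexp ((t + h / 2) * x) - iexp ((t + - (h / 2)) * x) = 2 * \<i> * of_real (sin (h * x / 2)) * iexp (t * x)" for x
  proof -
    have "iexp ((t + h / 2) * x) = iexp (t * x) * iexp (h * x / 2)"
      "iexp ((t + - (h / 2)) * x) = iexp (t * x) * iexp (- (h * x / 2))"
      by (simp_all add: algebra_simps flip: exp_add)
    moreover have "iexp (h * x / 2) - iexp (- (h * x / 2)) = 2 * \<i> * of_real (sin (h * x / 2))"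
      unfolding cis_conv_exp[symmetric] by (simp add: complex_eq_iff)
    ultimately show ?thesis by (simp only: right_diff_distrib[symmetric] mult.commute)
  qed
  have "(cdiff h ^^ Suc n) F (of_real t)
      = (cdiff h ^^ n) F (of_real (t + h / 2)) - (cdiff h ^^ n) F (of_real (t + - (h / 2)))"
    by (simp add: cdiff_def)
  also have "\<dots> = (CLINT x|M. (2 * \<i> * of_real (sin (h * x / 2))) ^ n * iexp ((t + h / 2) * x)
      - (2 * \<i> * of_real (sin (h * x / 2))) ^ n * iexp ((t + - (h / 2)) * x))"
    using h by (subst (1 2) *) (auto simp del: of_real_mult of_real_add of_real_minus intro!: Bochner_Integration.integral_diff[symmetric] int)
  also have "\<dots> = (CLINT x|M. (2 * \<i> * of_real (sin (h * x / 2))) ^ Suc n * iexp (t * x))"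
    unfolding right_diff_distrib[symmetric] e by (simp add: mult_ac)
  finally show ?case .
qed

text \<open>The integral of \<open>(2 sin (h x / 2) / h)\<^bsup>2 n\<^esup>\<close> is a difference quotient of \<open>F\<close>, which Cauchy's inequality
bounds uniformly in \<open>h\<close>. By Fatou's lemma the bound survives the limit \<open>h \<rightarrow> 0\<close>; existence
of the moments is part of the conclusion.\<close>

lemma (in real_distribution) even_moment_le:
  assumes hol: "F holomorphic_on UNIV" and "\<delta> > 0" "R > 0"
    and eq: "\<And>s. \<bar>s\<bar> < \<delta> \<Longrightarrow> char M s = F (of_real s)"
    and bnd: "\<And>z. norm z \<le> R + 1 \<Longrightarrow> norm (F z) \<le> B"
  shows "(\<integral>\<^sup>+x. ennreal (x ^ (2 * n)) \<partial>M) \<le> ennreal (fact (2 * n) * B / R ^ (2 * n))"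
proof -
  let ?C = "fact (2 * n) * B / R ^ (2 * n)"
  define h where "h m = 1 / real (Suc m)" for m
  have h_pos: "h m > 0" for m by (simp add: h_def)
  have h_lim: "h \<longlonglongrightarrow> 0" unfolding h_def using LIMSEQ_inverse_real_of_nat by (simp add: inverse_eq_divide)
  define u where "u m x = (2 * sin (h m * x / 2) / h m) ^ (2 * n)" for m x
  have cauchy: "norm ((deriv ^^ (2 * n)) F w) \<le> ?C" if "norm w \<le> 1" for w
  proof (rule Cauchy_inequality)
    show "F holomorphic_on ball w R" using hol by (rule holomorphic_on_subset) simp
    show "continuous_on (cball w R) F"
      using hol by (meson holomorphic_on_imp_continuous_on holomorphic_on_subset subset_UNIV)
    fix x assume "norm (w - x) = R"
    then show "norm (F x) \<le> B"
      using that norm_triangle_ineq4[of w "w - x"] by (intro bnd) simp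
  qed fact
  have "\<forall>\<^sub>F m in sequentially. (\<integral>\<^sup>+x. ennreal (u m x) \<partial>M) \<le> ennreal ?C"
  proof -
    have "(\<lambda>m. real n * h m) \<longlonglongrightarrow> real n * 0" by (intro tendsto_intros h_lim)
    then have "\<forall>\<^sub>F m in sequentially. real n * h m < min \<delta> 1"
      using \<open>\<delta> > 0\<close> by (intro order_tendstoD(2)) auto
    then show ?thesis
    proof eventually_elim
      case (elim m)
      let ?s = "\<lambda>x. 2 * sin (h m * x / 2)"
      have bd: "\<bar>?s x ^ (2 * n)\<bar> \<le> 2 ^ (2 * n)" for x
        unfolding power_abs by (intro power_mono) (auto simp: abs_mult)
      have int: "integrable M (\<lambda>x. ?s x ^ (2 * n))"
        using bd by (intro integrable_const_bound[of _ "2 ^ (2 * n)"]) auto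
      have "(cdiff (h m) ^^ (2 * n)) F (of_real 0) = (CLINT x|M. (2 * \<i> * of_real (sin (h m * x / 2))) ^ (2 * n) * iexp (0 * x))"
        using elim h_pos[of m] by (intro char_central_difference[OF eq]) auto
      also have "\<dots> = (CLINT x|M. (-1) ^ n * of_real (?s x ^ (2 * n)))"
      proof (intro Bochner_Integration.integral_cong refl)
        fix x
        have "(2 * \<i> * of_real (sin (h m * x / 2)))\<^sup>2 = -1 * of_real ((?s x)\<^sup>2)"
          by (simp add: power_mult_distrib)
        then have "(2 * \<i> * of_real (sin (h m * x / 2))) ^ (2 * n) = (-1 * of_real ((?s x)\<^sup>2)) ^ n"
          unfolding power_mult by simp
        also have "\<dots> = (-1) ^ n * of_real ((?s x)\<^sup>2) ^ n" by (rule power_mult_distrib)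
        also have "\<dots> = (-1) ^ n * of_real (?s x ^ (2 * n))" by (simp only: power_mult of_real_power)
        finally show "(2 * \<i> * of_real (sin (h m * x / 2))) ^ (2 * n) * iexp (0 * x) = (-1) ^ n * of_real (?s x ^ (2 * n))"
          by simp
      qed
      also have "\<dots> = (-1) ^ n * (CLINT x|M. of_real (?s x ^ (2 * n)))"
        by (rule integral_mult_right_zero)
      also have "\<dots> = (-1) ^ n * of_real (LINT x|M. ?s x ^ (2 * n))"
        by (simp only: integral_complex_of_real)
      finally have "norm ((cdiff (h m) ^^ (2 * n)) F 0) = norm ((-1) ^ n * complex_of_real (LINT x|M. ?s x ^ (2 * n)))"
        by (simp only: of_real_0)
      also have "\<dots> = \<bar>LINT x|M. ?s x ^ (2 * n)\<bar>"
        by (simp only: norm_mult norm_power norm_minus_cancel norm_one power_one norm_of_real mult_1_left)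
      finally have "norm ((cdiff (h m) ^^ (2 * n)) F 0) = \<bar>LINT x|M. ?s x ^ (2 * n)\<bar>" .
      moreover have "norm ((cdiff (h m) ^^ (2 * n)) F 0) \<le> ?C * h m ^ (2 * n)"
      proof (rule norm_cdiff_funpow_le[OF hol])
        show "norm ((deriv ^^ (2 * n)) F w) \<le> ?C" if "norm (w - 0) \<le> real (2 * n) * h m / 2" for w
          using that elim by (intro cauchy) simp
      qed (use h_pos[of m] in simp)
      ultimately have le: "(LINT x|M. ?s x ^ (2 * n)) \<le> ?C * h m ^ (2 * n)" by simp
      have "(\<integral>\<^sup>+x. ennreal (u m x) \<partial>M) = ennreal (LINT x|M. u m x)"
        using int by (intro nn_integral_eq_integral) (auto simp: u_def power_divide zero_le_even_power)
      also have "(LINT x|M. u m x) = (LINT x|M. ?s x ^ (2 * n)) / h m ^ (2 * n)"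
        by (simp add: u_def power_divide)
      also have "ennreal \<dots> \<le> ennreal ?C"
        using le h_pos[of m] by (intro ennreal_leI) (simp add: divide_le_eq)
      finally show ?case .
    qed
  qed
  then have "liminf (\<lambda>m. \<integral>\<^sup>+x. ennreal (u m x) \<partial>M) \<le> ennreal ?C"
    by (intro order_trans[OF Liminf_le_Limsup Limsup_bounded]) simp_all
  moreover have "(\<integral>\<^sup>+x. liminf (\<lambda>m. ennreal (u m x)) \<partial>M) \<le> liminf (\<lambda>m. \<integral>\<^sup>+x. ennreal (u m x) \<partial>M)"
    by (intro nn_integral_liminf) (auto simp: u_def)
  moreover have "liminf (\<lambda>m. ennreal (u m x)) = ennreal (x ^ (2 * n))" for x
  proof -
    have "(\<lambda>m. 2 * sin (h m * x / 2) / h m) \<longlonglongrightarrow> x"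
    proof -
      have "((\<lambda>t::real. 2 * sin (t * x / 2)) has_real_derivative x) (at 0)"
        by (auto intro!: derivative_eq_intros)
      then have "(\<lambda>t. 2 * sin (t * x / 2) / t) \<midarrow>0\<rightarrow> x"
        by (simp add: DERIV_def)
      then show ?thesis
        using h_lim h_pos by (auto simp: LIMSEQ_SEQ_conv[symmetric] tendsto_at_iff_sequentially comp_def less_imp_neq[symmetric])
    qed
    then have "(\<lambda>m. ennreal (u m x)) \<longlonglongrightarrow> ennreal (x ^ (2 * n))"
      unfolding u_def by (intro tendsto_ennrealI tendsto_power)
    then show ?thesis by (intro lim_imp_Liminf) auto
  qed
  ultimately show ?thesis by simp
qed

text \<open>The moment bounds with \<open>R = 2 r + 2\<close> make the even power series of \<open>cosh (r x)\<close> integrable term by term, with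
a geometric majorant of ratio \<open>1 / 2\<close>. Only the even moments matter because \<open>exp (r \<bar>x\<bar>) \<le> 2 cosh (r x)\<close>.\<close>

lemma (in real_distribution) exp_moment_le:
  assumes hol: "F holomorphic_on UNIV" and "\<delta> > 0" "r \<ge> 0"
    and eq: "\<And>s. \<bar>s\<bar> < \<delta> \<Longrightarrow> char M s = F (of_real s)"
    and bnd: "\<And>z. norm z \<le> 2 * r + 3 \<Longrightarrow> norm (F z) \<le> B"
  shows "(\<integral>\<^sup>+x. ennreal (exp (r * \<bar>x\<bar>)) \<partial>M) \<le> ennreal (4 * B)"
proof -
  define R where "R = 2 * r + 2"
  have R: "R > 0" "r \<le> R / 2" using \<open>r \<ge> 0\<close> by (auto simp: R_def)
  have B: "B \<ge> 0" using bnd[of 0] \<open>r \<ge> 0\<close> norm_ge_zero[of "F 0"] by (simp del: norm_ge_zero)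
  define c where "c k x = (if even k then (r * x) ^ k /\<^sub>R fact k else 0)" for k and x :: real
  have c_sums: "(\<lambda>k. c k x) sums cosh (r * x)" for x
    unfolding c_def by (rule cosh_converges)
  have c_nn: "c k x \<ge> 0" for k x by (auto simp: c_def zero_le_even_power)
  have "(\<integral>\<^sup>+x. ennreal (cosh (r * x)) \<partial>M) = (\<integral>\<^sup>+x. (\<Sum>k. ennreal (c k x)) \<partial>M)"
    using suminf_ennreal_eq[OF c_nn c_sums] by simp
  also have "\<dots> = (\<Sum>k. \<integral>\<^sup>+x. ennreal (c k x) \<partial>M)"
    by (intro nn_integral_suminf) (auto simp: c_def)
  also have "\<dots> \<le> (\<Sum>k. ennreal (B * (1 / 2) ^ k))"
  proof (rule suminf_le)
    fix k
    show "(\<integral>\<^sup>+x. ennreal (c k x) \<partial>M) \<le> ennreal (B * (1 / 2) ^ k)"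
    proof (cases "even k")
      case False
      then show ?thesis by (simp add: c_def)
    next
      case True
      then obtain n where k: "k = 2 * n" by (elim evenE)
      have "(\<integral>\<^sup>+x. ennreal (c k x) \<partial>M) = (\<integral>\<^sup>+x. ennreal (r ^ k / fact k) * ennreal (x ^ (2 * n)) \<partial>M)"
      proof (rule nn_integral_cong)
        fix x :: real
        have c_eq: "c k x = r ^ k / fact k * x ^ (2 * n)"
          using True by (simp add: c_def power_mult_distrib divide_simps flip: k)
        show "ennreal (c k x) = ennreal (r ^ k / fact k) * ennreal (x ^ (2 * n))"
          unfolding c_eq using \<open>r \<ge> 0\<close> by (intro ennreal_mult') simp
      qed
      also have "\<dots> = ennreal (r ^ k / fact k) * (\<integral>\<^sup>+x. ennreal (x ^ (2 * n)) \<partial>M)"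
        by (intro nn_integral_cmult) simp
      also have "\<dots> \<le> ennreal (r ^ k / fact k) * ennreal (fact (2 * n) * B / R ^ (2 * n))"
        using bnd by (intro mult_left_mono even_moment_le[OF hol \<open>\<delta> > 0\<close> R(1) eq]) (auto simp: R_def)
      also have "\<dots> = ennreal (B * (r / R) ^ k)"
        using \<open>r \<ge> 0\<close> by (simp add: k power_divide mult.commute flip: ennreal_mult')
      also have "\<dots> \<le> ennreal (B * (1 / 2) ^ k)"
        using R \<open>r \<ge> 0\<close> B by (intro ennreal_leI mult_left_mono power_mono) (auto simp: divide_le_eq)
      finally show ?thesis .
    qed
  qed auto
  also have "\<dots> = ennreal (B * 2)"
  proof (rule suminf_ennreal_eq)
    show "(\<lambda>k. B * (1 / 2) ^ k) sums (B * 2)"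
      using geometric_sums[of "1 / 2 :: real"] by (intro sums_mult) simp
  qed (use B in simp)
  finally have cosh_le: "(\<integral>\<^sup>+x. ennreal (cosh (r * x)) \<partial>M) \<le> ennreal (B * 2)" .
  have "(\<integral>\<^sup>+x. ennreal (exp (r * \<bar>x\<bar>)) \<partial>M) \<le> (\<integral>\<^sup>+x. 2 * ennreal (cosh (r * x)) \<partial>M)"
  proof (rule nn_integral_mono)
    fix x
    have "exp (r * \<bar>x\<bar>) \<le> 2 * cosh (r * x)"
      by (cases "x \<ge> 0") (auto simp: cosh_def)
    then show "ennreal (exp (r * \<bar>x\<bar>)) \<le> 2 * ennreal (cosh (r * x))"
      using ennreal_leI[of "exp (r * \<bar>x\<bar>)" "2 * cosh (r * x)"] by (simp add: ennreal_mult)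
  qed
  also have "\<dots> = 2 * (\<integral>\<^sup>+x. ennreal (cosh (r * x)) \<partial>M)"
    by (intro nn_integral_cmult) (simp add: cosh_def)
  also have "\<dots> \<le> 2 * ennreal (B * 2)" by (intro mult_left_mono cosh_le) simp
  also have "\<dots> = ennreal (4 * B)" using ennreal_mult'[of 2 "B * 2"] by (simp add: mult.commute)
  finally show ?thesis .
qed

section \<open>Entire moment generating functions\<close>

definition cmgf :: "real measure \<Rightarrow> complex \<Rightarrow> complex" where
  "cmgf M z = (CLINT x|M. exp (z * of_real x))"

text \<open>The base \<open>1 + r\<close> instead of \<open>r\<close> makes the bound monotone in the exponent \<open>m\<close>, so that estimates with
different exponents combine easily.\<close>

definition poly_exp_moments :: "real measure \<Rightarrow> bool" where
  "poly_exp_moments M \<longleftrightarrow>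
     (\<exists>K\<ge>0. \<exists>m. \<forall>r\<ge>0. (\<integral>\<^sup>+x. ennreal (exp (r * \<bar>x\<bar>)) \<partial>M) \<le> ennreal (exp (K * (1 + r) ^ m)))"

lemma exp_partial_sum_le:
  assumes "0 \<le> (u::real)"
  shows "(\<Sum>n<k. u ^ n / fact n) \<le> exp u"
proof -
  have "(\<lambda>n. u ^ n / fact n) sums exp u"
    using exp_converges[of u] by (simp add: divide_inverse mult.commute)
  then show ?thesis using assms sum_le_suminf[of "\<lambda>n. u ^ n / fact n" "{..<k}"]
    by (auto simp: sums_iff)
qed

lemma (in real_distribution) integrable_exp_abs:
  assumes "poly_exp_moments M" "r \<ge> 0"
  shows "integrable M (\<lambda>x. exp (r * \<bar>x\<bar>))"
proof (rule integrableI_nonneg)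
  obtain K m where "(\<integral>\<^sup>+x. ennreal (exp (r * \<bar>x\<bar>)) \<partial>M) \<le> ennreal (exp (K * (1 + r) ^ m))"
    using assms unfolding poly_exp_moments_def by blast
  then show "(\<integral>\<^sup>+x. ennreal (exp (r * \<bar>x\<bar>)) \<partial>M) < \<infinity>"
    by (rule le_less_trans) simp
qed auto

lemma norm_exp_mult_le: "norm (exp (z * of_real x)) \<le> exp (norm z * \<bar>x\<bar>)" for z :: complex and x :: real
proof -
  have "Re z * x \<le> \<bar>Re z\<bar> * \<bar>x\<bar>" by (metis abs_ge_self abs_mult)
  also have "\<dots> \<le> norm z * \<bar>x\<bar>" by (intro mult_right_mono abs_Re_le_cmod) simp
  finally show ?thesis by (simp add: norm_exp_eq_Re)
qed

lemma (in real_distribution) cmgf_sums: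
  assumes "poly_exp_moments M"
  shows "(\<lambda>n. (CLINT x|M. of_real x ^ n) / fact n * z ^ n) sums cmgf M z"
proof -
  let ?s = "\<lambda>k x. \<Sum>n<k. (z * of_real x) ^ n / fact n"
  have ps: "norm (\<Sum>n<k. (w * of_real x) ^ n / fact n) \<le> exp (norm w * \<bar>x\<bar>)" for k x and w :: complex
  proof -
    have "norm (\<Sum>n<k. (w * of_real x) ^ n / fact n) \<le> (\<Sum>n<k. (norm w * \<bar>x\<bar>) ^ n / fact n)"
      by (rule order_trans[OF norm_sum]) (simp add: norm_divide norm_power norm_mult)
    also have "\<dots> \<le> exp (norm w * \<bar>x\<bar>)" by (rule exp_partial_sum_le) simp
    finally show ?thesis .
  qed
  have mom: "integrable M (\<lambda>x. complex_of_real x ^ n)" for n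
  proof (rule Bochner_Integration.integrable_bound)
    show "integrable M (\<lambda>x. fact n * exp (1 * \<bar>x\<bar>))"
      using integrable_exp_abs[OF assms, of 1] by (intro integrable_mult_right) simp
    show "AE x in M. norm (complex_of_real x ^ n) \<le> norm (fact n * exp (1 * \<bar>x\<bar>) :: real)"
    proof (rule AE_I2)
      fix x :: real
      have "\<bar>x\<bar> ^ n / fact n \<le> (\<Sum>i<Suc n. \<bar>x\<bar> ^ i / fact i)"
        by (simp add: sum_nonneg)
      also have "\<dots> \<le> exp \<bar>x\<bar>" by (rule exp_partial_sum_le) simp
      finally show "norm (complex_of_real x ^ n) \<le> norm (fact n * exp (1 * \<bar>x\<bar>) :: real)"
        by (simp add: norm_power abs_mult field_simps)
    qed
  qed auto
  have "(\<lambda>k. CLINT x|M. ?s k x) \<longlonglongrightarrow> (CLINT x|M. exp (z * of_real x))"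
  proof (rule integral_dominated_convergence)
    show "integrable M (\<lambda>x. exp (norm z * \<bar>x\<bar>))" by (rule integrable_exp_abs[OF assms]) simp
    show "AE x in M. norm (?s k x) \<le> exp (norm z * \<bar>x\<bar>)" for k using ps by simp
    show "AE x in M. (\<lambda>k. ?s k x) \<longlonglongrightarrow> exp (z * of_real x)"
    proof (rule AE_I2)
      fix x
      show "(\<lambda>k. ?s k x) \<longlonglongrightarrow> exp (z * of_real x)"
        using exp_converges[of "z * of_real x"] by (simp add: sums_def scaleR_conv_of_real divide_inverse mult.commute)
    qed
  qed auto
  moreover have "(CLINT x|M. ?s k x) = (\<Sum>n<k. (CLINT x|M. of_real x ^ n) / fact n * z ^ n)" for k
    using mom by (simp add: Bochner_Integration.integral_sum power_mult_distrib mult.commute)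
  ultimately show ?thesis by (simp add: sums_def cmgf_def)
qed

lemma (in real_distribution) cmgf_holomorphic:
  assumes "poly_exp_moments M"
  shows "cmgf M holomorphic_on UNIV"
proof -
  have "cmgf M holomorphic_on ball 0 r" for r
    using cmgf_sums[OF assms]
    by (intro power_series_holomorphic[where a = "\<lambda>n. (CLINT x|M. of_real x ^ n) / fact n"]) simp
  then have "cmgf M field_differentiable at z" for z
    by (rule holomorphic_on_imp_differentiable_at[of _ "ball 0 (norm z + 1)"]) auto
  then show ?thesis by (simp add: holomorphic_on_def field_differentiable_at_within)
qed

lemma (in real_distribution) norm_cmgf_le_Re:
  "norm (cmgf M z) \<le> norm (cmgf M (of_real (Re z)))"
proof -
  have "norm (cmgf M z) \<le> (LINT x|M. norm (exp (z * of_real x)))"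
    unfolding cmgf_def by (rule integral_norm_bound)
  also have "\<dots> = (LINT x|M. exp (Re z * x))" by (simp add: norm_exp_eq_Re)
  also have "\<dots> \<le> norm (complex_of_real (LINT x|M. exp (Re z * x)))" by simp
  also have "complex_of_real (LINT x|M. exp (Re z * x)) = cmgf M (of_real (Re z))"
    unfolding cmgf_def integral_complex_of_real[symmetric] of_real_mult[symmetric] exp_of_real ..
  finally show ?thesis .
qed

lemma (in real_distribution) norm_cmgf_growth:
  assumes "poly_exp_moments M"
  shows "\<exists>K\<ge>0. \<exists>m. \<forall>z. norm (cmgf M z) \<le> exp (K * (1 + norm z) ^ m)"
proof -
  obtain K m where K: "K \<ge> 0" and
    bd: "\<And>r. r \<ge> 0 \<Longrightarrow> (\<integral>\<^sup>+x. ennreal (exp (r * \<bar>x\<bar>)) \<partial>M) \<le> ennreal (exp (K * (1 + r) ^ m))"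
    using assms unfolding poly_exp_moments_def by blast
  have "norm (cmgf M z) \<le> exp (K * (1 + norm z) ^ m)" for z
  proof -
    have int: "integrable M (\<lambda>x. exp (norm z * \<bar>x\<bar>))"
      by (rule integrable_exp_abs[OF assms]) simp
    have "norm (cmgf M z) \<le> (LINT x|M. norm (exp (z * of_real x)))"
      unfolding cmgf_def by (rule integral_norm_bound)
    also have "\<dots> \<le> (LINT x|M. exp (norm z * \<bar>x\<bar>))"
      using int norm_exp_mult_le[of z] by (intro integral_mono' int) auto
    also have "\<dots> \<le> exp (K * (1 + norm z) ^ m)"
      using bd[of "norm z"] nn_integral_eq_integral[OF int] by simp
    finally show ?thesis .
  qed
  then show ?thesis using K by blast
qed

lemma cmgf_imaginary: "cmgf M (\<i> * of_real t) = char M t"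
  by (simp add: cmgf_def char_def mult_ac)

lemma (in real_distribution) cmgf_0: "cmgf M 0 = 1"
  using prob_space by (simp add: cmgf_def)

lemma real_distribution_convolution:
  assumes "real_distribution \<mu>" "real_distribution \<nu>"
  shows "real_distribution (\<mu> \<star> \<nu>)"
proof -
  interpret \<mu>: real_distribution \<mu> by fact
  interpret \<nu>: real_distribution \<nu> by fact
  interpret pair_prob_space \<mu> \<nu> ..
  show ?thesis unfolding convolution_def
    by (intro real_distribution_distr) simp
qed

lemma char_convolution:
  assumes "real_distribution \<mu>" "real_distribution \<nu>"
  shows "char (\<mu> \<star> \<nu>) t = char \<mu> t * char \<nu> t"
proof -
  interpret \<mu>: real_distribution \<mu> by fact
  interpret \<nu>: real_distribution \<nu> by fact
  interpret pair_prob_space \<mu> \<nu> ..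
  have int: "integrable (\<mu> \<Otimes>\<^sub>M \<nu>) (\<lambda>(x, y). iexp (t * (x + y)))"
    by (intro integrable_const_bound[of _ 1]) (auto simp: case_prod_beta)
  have "char (\<mu> \<star> \<nu>) t = (CLINT z|\<mu> \<Otimes>\<^sub>M \<nu>. case z of (x, y) \<Rightarrow> iexp (t * (x + y)))"
    unfolding char_def convolution_def by (subst integral_distr) (auto simp: case_prod_unfold)
  also have "\<dots> = (CLINT x|\<mu>. CLINT y|\<nu>. iexp (t * (x + y)))"
    using integral_fst'[OF int] by simp
  also have "\<dots> = (CLINT x|\<mu>. iexp (t * x) * char \<nu> t)"
    by (simp add: char_def distrib_left exp_add)
  also have "\<dots> = char \<mu> t * char \<nu> t" by (simp add: char_def)
  finally show ?thesis .
qed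

section \<open>Convolution factors of exponentials of polynomials\<close>

text \<open>For comparing the tails of \<open>\<mu>\<close> with those of \<open>\<mu> \<star> \<nu>\<close>: any fixed positive mass would serve.\<close>

lemma (in real_distribution) half_mass_interval:
  "\<exists>a\<ge>0. measure M {x. \<bar>x\<bar> \<le> a} \<ge> 1 / 2"
proof -
  have "(\<lambda>n. measure M {x. \<bar>x\<bar> \<le> real n}) \<longlonglongrightarrow> measure M (\<Union>n. {x. \<bar>x\<bar> \<le> real n})"
    by (rule finite_Lim_measure_incseq) (auto simp: incseq_def)
  also have "(\<Union>n. {x::real. \<bar>x\<bar> \<le> real n}) = space M"
    using real_arch_simple by auto
  finally have "\<forall>\<^sub>F n in sequentially. measure M {x. \<bar>x\<bar> \<le> real n} > 1 / 2"
    by (rule order_tendstoD(1)) (simp add: prob_space del: space_eq_univ)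
  then obtain n where "measure M {x. \<bar>x\<bar> \<le> real n} > 1 / 2"
    by (auto simp: eventually_sequentially)
  then show ?thesis by (intro exI[of _ "real n"]) auto
qed

text \<open>With probability at least \<open>1 / 2\<close> the second summand is at most \<open>a\<close> in absolute value, and then
\<open>\<bar>x + y\<bar> \<ge> \<bar>x\<bar> - a\<close>. So a factor of a convolution inherits exponential integrability.\<close>

lemma exp_moment_convolution_ge:
  assumes "real_distribution \<mu>" "real_distribution \<nu>"
  shows "\<exists>a\<ge>0. \<forall>r\<ge>0. (\<integral>\<^sup>+x. ennreal (exp (r * \<bar>x\<bar>)) \<partial>\<mu>)
      \<le> ennreal (2 * exp (r * a)) * (\<integral>\<^sup>+x. ennreal (exp (r * \<bar>x\<bar>)) \<partial>(\<mu> \<star> \<nu>))"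
proof -
  interpret \<mu>: real_distribution \<mu> by fact
  interpret \<nu>: real_distribution \<nu> by fact
  obtain a where a: "a \<ge> 0" "measure \<nu> {x. \<bar>x\<bar> \<le> a} \<ge> 1 / 2"
    using \<nu>.half_mass_interval by blast
  let ?S = "{x::real. \<bar>x\<bar> \<le> a}"
  have "(\<integral>\<^sup>+x. ennreal (exp (r * \<bar>x\<bar>)) \<partial>\<mu>)
      \<le> ennreal (2 * exp (r * a)) * (\<integral>\<^sup>+x. ennreal (exp (r * \<bar>x\<bar>)) \<partial>(\<mu> \<star> \<nu>))" if r: "r \<ge> 0" for r
  proof -
    have "ennreal (exp (r * \<bar>x\<bar>)) \<le> ennreal (2 * exp (r * a)) * (\<integral>\<^sup>+y. ennreal (exp (r * \<bar>x + y\<bar>)) \<partial>\<nu>)" for x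
    proof -
      have "ennreal (exp (r * \<bar>x\<bar>)) \<le> ennreal (2 * exp (r * a)) * (ennreal (exp (r * (\<bar>x\<bar> - a))) * ennreal (measure \<nu> ?S))"
      proof -
        have "exp (r * \<bar>x\<bar>) = 2 * exp (r * a) * (exp (r * (\<bar>x\<bar> - a)) * (1 / 2))"
          by (simp add: right_diff_distrib flip: exp_add)
        also have "\<dots> \<le> 2 * exp (r * a) * (exp (r * (\<bar>x\<bar> - a)) * measure \<nu> ?S)"
          using a by (intro mult_left_mono) auto
        finally show ?thesis by (simp add: ennreal_leI flip: ennreal_mult')
      qed
      also have "ennreal (exp (r * (\<bar>x\<bar> - a))) * ennreal (measure \<nu> ?S)
          = (\<integral>\<^sup>+y. ennreal (exp (r * (\<bar>x\<bar> - a))) * indicator ?S y \<partial>\<nu>)"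
        by (simp add: nn_integral_cmult_indicator \<nu>.emeasure_eq_measure)
      also have "\<dots> \<le> (\<integral>\<^sup>+y. ennreal (exp (r * \<bar>x + y\<bar>)) \<partial>\<nu>)"
        using r by (intro nn_integral_mono) (auto simp: indicator_def intro!: ennreal_leI mult_left_mono)
      finally show ?thesis by (simp add: mult_left_mono)
    qed
    then have "(\<integral>\<^sup>+x. ennreal (exp (r * \<bar>x\<bar>)) \<partial>\<mu>)
        \<le> (\<integral>\<^sup>+x. ennreal (2 * exp (r * a)) * (\<integral>\<^sup>+y. ennreal (exp (r * \<bar>x + y\<bar>)) \<partial>\<nu>) \<partial>\<mu>)"
      by (rule nn_integral_mono)
    also have "\<dots> = ennreal (2 * exp (r * a)) * (\<integral>\<^sup>+x. \<integral>\<^sup>+y. ennreal (exp (r * \<bar>x + y\<bar>)) \<partial>\<nu> \<partial>\<mu>)"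
      by (intro nn_integral_cmult) measurable
    also have "(\<integral>\<^sup>+x. \<integral>\<^sup>+y. ennreal (exp (r * \<bar>x + y\<bar>)) \<partial>\<nu> \<partial>\<mu>) = (\<integral>\<^sup>+x. ennreal (exp (r * \<bar>x\<bar>)) \<partial>(\<mu> \<star> \<nu>))"
      by (subst nn_integral_convolution) (auto simp: \<mu>.finite_measure_axioms \<nu>.finite_measure_axioms)
    finally show ?thesis .
  qed
  then show ?thesis using a by blast
qed

lemma norm_poly_le:
  fixes p :: "complex poly"
  shows "\<exists>C\<ge>0. \<forall>z. norm (poly p z) \<le> C * (1 + norm z) ^ degree p"
proof -
  let ?C = "\<Sum>i\<le>degree p. norm (coeff p i)"
  have "norm (poly p z) \<le> ?C * (1 + norm z) ^ degree p" for z
  proof -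
    have "norm (poly p z) \<le> (\<Sum>i\<le>degree p. norm (coeff p i * z ^ i))"
      unfolding poly_altdef by (rule norm_sum)
    also have "\<dots> \<le> (\<Sum>i\<le>degree p. norm (coeff p i) * (1 + norm z) ^ degree p)"
    proof (rule sum_mono)
      fix i assume "i \<in> {..degree p}"
      then have "(1 + norm z) ^ i \<le> (1 + norm z) ^ degree p" by (intro power_increasing) auto
      moreover have "norm z ^ i \<le> (1 + norm z) ^ i" by (intro power_mono) auto
      ultimately show "norm (coeff p i * z ^ i) \<le> norm (coeff p i) * (1 + norm z) ^ degree p"
        by (simp add: norm_mult norm_power mult_left_mono)
    qed
    finally show ?thesis by (simp add: sum_distrib_right)
  qed
  then show ?thesis by (intro exI[of _ ?C]) (auto intro: sum_nonneg)
qed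

lemma poly_exp_moments_of_local_exp_poly:
  assumes \<mu>: "real_distribution \<mu>" and \<nu>: "real_distribution \<nu>" and "\<delta> > 0"
    and eq: "\<And>t. \<bar>t\<bar> < \<delta> \<Longrightarrow> char \<mu> t * char \<nu> t = exp (poly P (of_real t))"
  shows "poly_exp_moments \<mu>"
proof -
  interpret \<kappa>: real_distribution "\<mu> \<star> \<nu>" by (rule real_distribution_convolution[OF \<mu> \<nu>])
  obtain C where C: "C \<ge> 0" "\<And>z. norm (poly P z) \<le> C * (1 + norm z) ^ degree P"
    using norm_poly_le[of P] by blast
  obtain a where a: "a \<ge> 0" and le: "\<And>r. r \<ge> 0 \<Longrightarrow> (\<integral>\<^sup>+x. ennreal (exp (r * \<bar>x\<bar>)) \<partial>\<mu>)
      \<le> ennreal (2 * exp (r * a)) * (\<integral>\<^sup>+x. ennreal (exp (r * \<bar>x\<bar>)) \<partial>(\<mu> \<star> \<nu>))"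
    using exp_moment_convolution_ge[OF \<mu> \<nu>] by blast
  let ?n = "degree P"
  define K where "K = 3 + a + C * 4 ^ ?n"
  have K: "K \<ge> 0" using a C by (simp add: K_def)
  have "(\<integral>\<^sup>+x. ennreal (exp (r * \<bar>x\<bar>)) \<partial>\<mu>) \<le> ennreal (exp (K * (1 + r) ^ Suc ?n))" if r: "r \<ge> 0" for r
  proof -
    have "(\<integral>\<^sup>+x. ennreal (exp (r * \<bar>x\<bar>)) \<partial>(\<mu> \<star> \<nu>)) \<le> ennreal (4 * exp (C * (4 * (1 + r)) ^ ?n))"
    proof (rule \<kappa>.exp_moment_le[where F = "\<lambda>z. exp (poly P z)"])
      show "(\<lambda>z. exp (poly P z)) holomorphic_on UNIV" by (intro holomorphic_intros)
      show "char (\<mu> \<star> \<nu>) s = exp (poly P (of_real s))" if "\<bar>s\<bar> < \<delta>" for s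
        using eq[OF that] by (simp add: char_convolution[OF \<mu> \<nu>])
      fix z :: complex assume z: "norm z \<le> 2 * r + 3"
      have "norm (exp (poly P z)) \<le> exp (norm (poly P z))" by (rule norm_exp)
      also have "\<dots> \<le> exp (C * (1 + norm z) ^ ?n)" using C(2) by simp
      also have "\<dots> \<le> exp (C * (4 * (1 + r)) ^ ?n)"
        using z r C(1) unfolding exp_le_cancel_iff by (intro mult_left_mono power_mono) auto
      finally show "norm (exp (poly P z)) \<le> exp (C * (4 * (1 + r)) ^ ?n)" .
    qed (use \<open>\<delta> > 0\<close> r in auto)
    then have "(\<integral>\<^sup>+x. ennreal (exp (r * \<bar>x\<bar>)) \<partial>\<mu>)
        \<le> ennreal (2 * exp (r * a)) * ennreal (4 * exp (C * (4 * (1 + r)) ^ ?n))"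
      using le[OF r] by (meson mult_left_mono order_trans zero_le)
    also have "\<dots> = ennreal (8 * exp (r * a + C * (4 * (1 + r)) ^ ?n))"
      by (simp add: exp_add mult_ac flip: ennreal_mult')
    also have "\<dots> \<le> ennreal (exp (K * (1 + r) ^ Suc ?n))"
    proof (rule ennreal_leI)
      have pow: "1 \<le> (1 + r) ^ k" for k using r by (intro one_le_power) simp
      have "(8::real) = 2 ^ 3" by simp
      also have "\<dots> \<le> exp 1 ^ 3" using exp_ge_add_one_self[of 1] by (intro power_mono) auto
      also have "\<dots> = exp 3" by (simp flip: exp_of_nat_mult)
      finally have "8 * exp (r * a + C * (4 * (1 + r)) ^ ?n) \<le> exp 3 * exp (r * a + C * (4 * (1 + r)) ^ ?n)"
        by (rule mult_right_mono) simp
      also have "\<dots> = exp (3 + r * a + C * 4 ^ ?n * (1 + r) ^ ?n)"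
        unfolding power_mult_distrib exp_add by (simp only: mult.assoc)
      also have "\<dots> \<le> exp (K * (1 + r) ^ Suc ?n)"
        unfolding exp_le_cancel_iff
      proof -
        have "3 * 1 \<le> 3 * (1 + r) ^ Suc ?n" using pow[of "Suc ?n"] by simp
        moreover have "r * a \<le> (1 + r) ^ Suc ?n * a"
        proof (rule mult_right_mono)
          have "r \<le> (1 + r) * 1" by simp
          also have "\<dots> \<le> (1 + r) * (1 + r) ^ ?n" using pow[of ?n] r by (intro mult_left_mono) auto
          finally show "r \<le> (1 + r) ^ Suc ?n" by simp
        qed fact
        moreover have "C * 4 ^ ?n * (1 + r) ^ ?n \<le> C * 4 ^ ?n * (1 + r) ^ Suc ?n"
          using r C(1) by (intro mult_left_mono power_increasing) auto
        ultimately show "3 + r * a + C * 4 ^ ?n * (1 + r) ^ ?n \<le> K * (1 + r) ^ Suc ?n"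
          by (simp add: K_def distrib_right mult.commute[of _ a] del: power_Suc)
      qed
      finally show "8 * exp (r * a + C * (4 * (1 + r)) ^ ?n) \<le> exp (K * (1 + r) ^ Suc ?n)" .
    qed
    finally show ?thesis .
  qed
  then show ?thesis unfolding poly_exp_moments_def using K by blast
qed

text \<open>For \<open>\<nu>\<close> the point mass at \<open>0\<close> this is Marcinkiewicz's theorem, and for a polynomial \<open>P\<close> of degree two it
is Cramer's theorem. The case \<open>d = 0\<close> is that of a point mass. The logarithm \<open>g\<close> of the moment generating
function of \<open>\<mu>\<close> exists since the product with that of \<open>\<nu>\<close> is an exponential and so has no zeros.\<close>

theorem cramer_marcinkiewicz:
  assumes \<mu>: "real_distribution \<mu>" and \<nu>: "real_distribution \<nu>" and \<delta>: "\<delta> > 0"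
    and eq: "\<And>t. \<bar>t\<bar> < \<delta> \<Longrightarrow> char \<mu> t * char \<nu> t = exp (poly P (of_real t))"
  shows "\<exists>a d::real. d \<ge> 0 \<and> (\<forall>t. char \<mu> t = exp (\<i> * of_real (a * t) - of_real (d * t\<^sup>2)))"
proof -
  interpret \<mu>: real_distribution \<mu> by fact
  interpret \<nu>: real_distribution \<nu> by fact
  have m\<mu>: "poly_exp_moments \<mu>" by (rule poly_exp_moments_of_local_exp_poly[OF \<mu> \<nu> \<delta> eq])
  have m\<nu>: "poly_exp_moments \<nu>"
    by (rule poly_exp_moments_of_local_exp_poly[OF \<nu> \<mu> \<delta>]) (simp add: eq mult.commute)
  let ?D = "\<lambda>z. cmgf \<mu> (\<i> * z) * cmgf \<nu> (\<i> * z) - exp (poly P z)"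
  have hol_i: "(\<lambda>z. f (\<i> * z)) holomorphic_on UNIV" if "f holomorphic_on UNIV" for f
    using holomorphic_on_compose[of "\<lambda>z. \<i> * z" UNIV f] that
    by (simp add: o_def holomorphic_on_subset holomorphic_intros)
  \<comment> \<open>Both sides are entire and agree on a real interval around the origin.\<close>
  have prod: "cmgf \<mu> (\<i> * z) * cmgf \<nu> (\<i> * z) = exp (poly P z)" for z
  proof -
    have "?D z = 0"
    proof (rule analytic_continuation[where f = ?D and S = UNIV and U = "of_real ` {-\<delta><..<\<delta>}" and \<xi> = 0])
      show "?D holomorphic_on UNIV"
        by (intro holomorphic_intros hol_i \<mu>.cmgf_holomorphic[OF m\<mu>] \<nu>.cmgf_holomorphic[OF m\<nu>])
      show "0 islimpt complex_of_real ` {-\<delta><..<\<delta>}"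
        unfolding islimpt_approachable
      proof (intro allI impI)
        fix e :: real assume "e > 0"
        then have "min e \<delta> / 2 \<in> {-\<delta><..<\<delta>}" "min e \<delta> / 2 \<noteq> 0" "\<bar>min e \<delta> / 2\<bar> < e" using \<delta> by auto
        then show "\<exists>x'\<in>complex_of_real ` {-\<delta><..<\<delta>}. x' \<noteq> 0 \<and> dist x' 0 < e"
          by (intro bexI[of _ "of_real (min e \<delta> / 2)"]) (auto simp del: of_real_divide)
      qed
      show "?D w = 0" if "w \<in> of_real ` {-\<delta><..<\<delta>}" for w
        using that eq by (auto simp: cmgf_imaginary)
    qed auto
    then show ?thesis by simp
  qed
  have nz: "cmgf \<mu> z \<noteq> 0" for z
    using prod[of "- \<i> * z"] by auto
  obtain g0 where g0: "g0 holomorphic_on UNIV" "\<And>z. exp (g0 z) = cmgf \<mu> z"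
    by (rule holomorphic_logarithm_exists[OF convex_UNIV open_UNIV \<mu>.cmgf_holomorphic[OF m\<mu>]]) (auto simp: nz)
  define g where "g z = g0 z - g0 0" for z
  have hol: "g holomorphic_on UNIV" unfolding g_def by (intro holomorphic_intros g0)
  have g_exp: "exp (g z) = cmgf \<mu> z" for z
    by (simp add: g_def exp_diff g0 \<mu>.cmgf_0)
  have Re_g: "norm (cmgf \<mu> z) = exp (Re (g z))" for z
    by (simp flip: g_exp)
  obtain K m where "K \<ge> 0" "\<And>z. norm (cmgf \<mu> z) \<le> exp (K * (1 + norm z) ^ m)"
    using \<mu>.norm_cmgf_growth[OF m\<mu>] by blast
  then obtain p where p: "\<And>z. g z = poly p z"
    using entire_polynomial_of_Re_bound[OF hol, of K m] by (auto simp: Re_g g_def)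
  have "\<exists>a d::real. 0 \<le> d \<and> (\<forall>z. poly p z = of_real a * z + of_real d * z\<^sup>2)"
  proof (rule ridge_dominated_quadratic)
    show "Re (poly p z) \<le> Re (poly p (of_real (Re z)))" for z
      using \<mu>.norm_cmgf_le_Re[of z] by (simp add: Re_g p)
    show "poly p 0 = 0" using p[of 0] by (simp add: g_def)
  qed
  then obtain a d :: real where "d \<ge> 0" and q: "\<And>z. g z = of_real a * z + of_real d * z\<^sup>2"
    using p by auto
  moreover have "char \<mu> t = exp (\<i> * of_real (a * t) - of_real (d * t\<^sup>2))" for t
    unfolding cmgf_imaginary[symmetric] g_exp[symmetric] q by (simp add: power_mult_distrib mult_ac)
  ultimately show ?thesis by blast
qed

section \<open>The Darmois--Skitovich theorem\<close>

definition is_char :: "(real \<Rightarrow> complex) \<Rightarrow> bool" where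
  "is_char f \<longleftrightarrow> (\<exists>\<nu>. real_distribution \<nu> \<and> f = char \<nu>)"

lemma is_char_mult: "is_char f \<Longrightarrow> is_char g \<Longrightarrow> is_char (\<lambda>t. f t * g t)"
  unfolding is_char_def
proof (elim exE conjE)
  fix \<mu> \<nu>
  assume "real_distribution \<mu>" "f = char \<mu>" "real_distribution \<nu>" "g = char \<nu>"
  then show "\<exists>\<kappa>. real_distribution \<kappa> \<and> (\<lambda>t. f t * g t) = char \<kappa>"
    by (intro exI[of _ "\<mu> \<star> \<nu>"]) (simp add: real_distribution_convolution char_convolution fun_eq_iff)
qed

lemma real_distribution_return: "real_distribution (return borel c)"
  by (intro real_distribution.intro prob_space_return real_distribution_axioms.intro) auto

lemma char_return: "char (return borel c) t = iexp (t * c)"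
  by (simp add: char_def integral_return)

lemma is_char_prod:
  assumes "finite J" "\<And>j. j \<in> J \<Longrightarrow> is_char (f j)"
  shows "is_char (\<lambda>t. \<Prod>j\<in>J. f j t)"
  using assms
proof (induction J)
  case empty
  have "(\<lambda>t. 1) = char (return borel 0)" by (simp add: fun_eq_iff char_return)
  then show ?case using real_distribution_return by (auto simp: is_char_def)
next
  case (insert j J)
  then show ?case by (simp add: is_char_mult)
qed

lemma (in real_distribution) char_distr_scale: "char (distr M borel ((*) c)) t = char M (c * t)"
  by (simp add: char_def integral_distr mult_ac)

lemma is_char_scale:
  assumes "is_char f"
  shows "is_char (\<lambda>t. f (c * t))"
proof -
  obtain \<nu> where \<nu>: "real_distribution \<nu>" and f: "f = char \<nu>" using assms by (auto simp: is_char_def)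
  interpret real_distribution \<nu> by fact
  have "real_distribution (distr \<nu> borel ((*) c))" by (intro real_distribution_distr) simp
  then show ?thesis unfolding is_char_def f
    by (intro exI[of _ "distr \<nu> borel ((*) c)"]) (simp add: char_distr_scale fun_eq_iff)
qed

lemma char_uminus: "char M (- t) = cnj (char M t)"
proof -
  have "char M (- t) = (CLINT x|M. cnj (iexp (t * x)))" by (simp add: char_def exp_cnj)
  then show ?thesis by (simp only: char_def Bochner_Integration.integral_cnj)
qed

lemma is_char_cnj: "is_char f \<Longrightarrow> is_char (\<lambda>t. cnj (f t))"
  using is_char_scale[of f "-1"] by (auto simp: is_char_def char_uminus)

lemma factor_of_local_exp_poly:
  assumes "is_char f" "is_char g" "\<delta> > 0"
    and "\<And>t. \<bar>t\<bar> < \<delta> \<Longrightarrow> f t * g t = exp (poly P (of_real t))"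
  shows "\<exists>a d::real. d \<ge> 0 \<and> (\<forall>t. f t = exp (\<i> * of_real (a * t) - of_real (d * t\<^sup>2)))"
proof -
  obtain \<mu> \<nu> where "real_distribution \<mu>" "f = char \<mu>" "real_distribution \<nu>" "g = char \<nu>"
    using assms(1,2) by (auto simp: is_char_def)
  then show ?thesis using cramer_marcinkiewicz[of \<mu> \<nu> \<delta> P] assms(3,4) by simp
qed

text \<open>Finitely many characteristic functions have a common zero-free neighbourhood of the origin, within which
logarithms and cancellation are possible.\<close>

lemma chars_nonzero_near_0:
  fixes \<mu> :: "'k::finite \<Rightarrow> real measure" and \<alpha> \<beta> :: "'k \<Rightarrow> real"
  assumes "\<And>j. real_distribution (\<mu> j)"
  shows "\<exists>\<delta>>0. \<forall>j s t. \<bar>s\<bar> \<le> \<delta> \<longrightarrow> \<bar>t\<bar> \<le> \<delta> \<longrightarrow> char (\<mu> j) (\<alpha> j * s + \<beta> j * t) \<noteq> 0"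
proof -
  have "\<forall>\<^sub>F u in nhds 0. \<forall>j. char (\<mu> j) u \<noteq> 0"
  proof (rule eventually_all_finite)
    fix j
    interpret real_distribution "\<mu> j" by fact
    have "(char (\<mu> j) \<longlongrightarrow> 1) (nhds 0)"
      using isCont_char[of 0] by (simp add: char_zero continuous_at tendsto_nhds_iff)
    then show "\<forall>\<^sub>F u in nhds 0. char (\<mu> j) u \<noteq> 0"
      by (rule tendsto_imp_eventually_ne) simp
  qed
  then obtain \<eta> where \<eta>: "\<eta> > 0" "\<And>u j. \<bar>u\<bar> < \<eta> \<Longrightarrow> char (\<mu> j) u \<noteq> 0"
    by (auto simp: eventually_nhds_metric dist_real_def)
  define L where "L = 1 + (\<Sum>j\<in>UNIV. \<bar>\<alpha> j\<bar> + \<bar>\<beta> j\<bar>)"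
  have L: "L > 0" "\<bar>\<alpha> j\<bar> + \<bar>\<beta> j\<bar> < L" for j
  proof -
    show "L > 0" unfolding L_def by (intro add_pos_nonneg sum_nonneg) auto
    have "\<bar>\<alpha> j\<bar> + \<bar>\<beta> j\<bar> \<le> (\<Sum>j\<in>UNIV. \<bar>\<alpha> j\<bar> + \<bar>\<beta> j\<bar>)"
      by (rule member_le_sum) auto
    then show "\<bar>\<alpha> j\<bar> + \<bar>\<beta> j\<bar> < L" by (simp add: L_def)
  qed
  have "\<bar>\<alpha> j * s + \<beta> j * t\<bar> < \<eta>" if "\<bar>s\<bar> \<le> \<eta> / L" "\<bar>t\<bar> \<le> \<eta> / L" for j s t
  proof -
    have "\<bar>\<alpha> j * s + \<beta> j * t\<bar> \<le> \<bar>\<alpha> j\<bar> * \<bar>s\<bar> + \<bar>\<beta> j\<bar> * \<bar>t\<bar>"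
      by (metis abs_mult abs_triangle_ineq)
    also have "\<dots> \<le> \<bar>\<alpha> j\<bar> * (\<eta> / L) + \<bar>\<beta> j\<bar> * (\<eta> / L)"
      using that by (intro add_mono mult_left_mono) auto
    also have "\<dots> = (\<bar>\<alpha> j\<bar> + \<bar>\<beta> j\<bar>) * (\<eta> / L)" by (rule distrib_right[symmetric])
    also have "\<dots> < L * (\<eta> / L)" using L \<eta>(1) by (intro mult_strict_right_mono) auto
    finally show ?thesis using L by simp
  qed
  then show ?thesis using \<eta> L by (intro exI[of _ "\<eta> / L"]) auto
qed

lemma poly_map_poly_of_real:
  "poly (map_poly of_real p) (of_real x) = (of_real (poly p x) :: complex)"
  by (induction p) (simp_all add: map_poly_pCons)

text \<open>The hypothesis says that \<open>\<Sum>j. \<alpha> j * Z j\<close> and \<open>\<Sum>j. \<beta> j * Z j\<close> are independent for independent \<open>Z j\<close> with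
laws \<open>\<mu> j\<close>; the conclusion is that a variable occurring in both sums is Gaussian or constant. Summands
with proportional coefficients cannot be separated by the functional equation, so they are grouped by the ratio
\<open>\<beta> j / \<alpha> j\<close>. The ridge function of a group is a polynomial near the origin, hence the group as a
whole has an exponential of a polynomial as its (symmetrised) characteristic function, and
\<open>cramer_marcinkiewicz\<close> extracts the individual member \<open>l\<close>.\<close>

theorem darmois_skitovich:
  fixes \<mu> :: "'k::finite \<Rightarrow> real measure" and \<alpha> \<beta> :: "'k \<Rightarrow> real"
  assumes rd: "\<And>j. real_distribution (\<mu> j)"
    and eq: "\<And>s t. (\<Prod>j\<in>UNIV. char (\<mu> j) (\<alpha> j * s + \<beta> j * t))
        = (\<Prod>j\<in>UNIV. char (\<mu> j) (\<alpha> j * s)) * (\<Prod>j\<in>UNIV. char (\<mu> j) (\<beta> j * t))"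
    and l: "\<alpha> l \<noteq> 0" "\<beta> l \<noteq> 0"
  shows "\<exists>a d::real. d \<ge> 0 \<and> (\<forall>t. char (\<mu> l) t = exp (\<i> * of_real (a * t) - of_real (d * t\<^sup>2)))"
proof -
  define \<phi> where "\<phi> j = char (\<mu> j)" for j
  have is_char: "is_char (\<phi> j)" for j using rd by (auto simp: \<phi>_def is_char_def)
  have cont: "continuous_on S (\<phi> j)" for S j
    unfolding \<phi>_def by (intro continuous_at_imp_continuous_on ballI real_distribution.isCont_char rd)
  obtain \<delta> where \<delta>: "\<delta> > 0"
    and nz: "\<And>j s t. \<bar>s\<bar> \<le> \<delta> \<Longrightarrow> \<bar>t\<bar> \<le> \<delta> \<Longrightarrow> \<phi> j (\<alpha> j * s + \<beta> j * t) \<noteq> 0"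
    using chars_nonzero_near_0[where \<mu> = \<mu> and \<alpha> = \<alpha> and \<beta> = \<beta>, OF rd] unfolding \<phi>_def by blast
  define f where "f j u = ln (norm (\<phi> j u))" for j u
  have log_eq: "(\<Sum>j\<in>UNIV. f j (\<alpha> j * s + \<beta> j * t)) = (\<Sum>j\<in>UNIV. f j (\<alpha> j * s)) + (\<Sum>j\<in>UNIV. f j (\<beta> j * t))"
    if st: "\<bar>s\<bar> \<le> \<delta>" "\<bar>t\<bar> \<le> \<delta>" for s t
  proof -
    have n: "\<phi> j (\<alpha> j * s + \<beta> j * t) \<noteq> 0" "\<phi> j (\<alpha> j * s) \<noteq> 0" "\<phi> j (\<beta> j * t) \<noteq> 0" for j
      using nz[OF st, of j] nz[of s 0 j] nz[of 0 t j] st \<delta> by auto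
    have "(\<Sum>j\<in>UNIV. f j (\<alpha> j * s + \<beta> j * t)) = ln (norm (\<Prod>j\<in>UNIV. \<phi> j (\<alpha> j * s + \<beta> j * t)))"
      using n unfolding f_def prod_norm[symmetric] by (subst ln_prod) auto
    also have "(\<Prod>j\<in>UNIV. \<phi> j (\<alpha> j * s + \<beta> j * t)) = (\<Prod>j\<in>UNIV. \<phi> j (\<alpha> j * s)) * (\<Prod>j\<in>UNIV. \<phi> j (\<beta> j * t))"
      unfolding \<phi>_def by (rule eq)
    also have "ln (norm \<dots>) = ln (norm (\<Prod>j\<in>UNIV. \<phi> j (\<alpha> j * s))) + ln (norm (\<Prod>j\<in>UNIV. \<phi> j (\<beta> j * t)))"
      using n by (simp add: norm_mult ln_mult)
    also have "\<dots> = (\<Sum>j\<in>UNIV. f j (\<alpha> j * s)) + (\<Sum>j\<in>UNIV. f j (\<beta> j * t))"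
      using n unfolding f_def prod_norm[symmetric] by (subst (1 2) ln_prod) auto
    finally show ?thesis .
  qed
  \<comment> \<open>Terms with \<open>\<alpha> j = 0\<close> depend on \<open>t\<close> only and are absorbed into the right-hand side.\<close>
  define J where "J = {j. \<alpha> j \<noteq> 0}"
  define C where "C = (\<lambda>j. \<beta> j / \<alpha> j) ` J"
  define c0 where "c0 = \<beta> l / \<alpha> l"
  define \<psi> where "\<psi> c u = (\<Sum>j\<in>{j \<in> J. \<beta> j / \<alpha> j = c}. f j (\<alpha> j * u))" for c u
  have ridge: "(\<Sum>c\<in>C. \<psi> c (s + c * t)) = (\<Sum>j\<in>UNIV. f j (\<alpha> j * s))
      + ((\<Sum>j\<in>UNIV. f j (\<beta> j * t)) - (\<Sum>j\<in>- J. f j (\<beta> j * t)))"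
    if st: "\<bar>s\<bar> \<le> \<delta>" "\<bar>t\<bar> \<le> \<delta>" for s t
  proof -
    have "(\<Sum>c\<in>C. \<psi> c (s + c * t)) = (\<Sum>c\<in>C. \<Sum>j\<in>{j \<in> J. \<beta> j / \<alpha> j = c}. f j (\<alpha> j * s + \<beta> j * t))"
      unfolding \<psi>_def by (intro sum.cong refl) (auto simp: J_def distrib_left)
    also have "\<dots> = (\<Sum>j\<in>J. f j (\<alpha> j * s + \<beta> j * t))"
      by (intro sum.group) (auto simp: C_def)
    also have "\<dots> = (\<Sum>j\<in>UNIV. f j (\<alpha> j * s + \<beta> j * t)) - (\<Sum>j\<in>- J. f j (\<alpha> j * s + \<beta> j * t))"
      using sum.subset_diff[of J UNIV "\<lambda>j. f j (\<alpha> j * s + \<beta> j * t)"] by (simp add: Compl_eq_Diff_UNIV)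
    also have "(\<Sum>j\<in>- J. f j (\<alpha> j * s + \<beta> j * t)) = (\<Sum>j\<in>- J. f j (\<beta> j * t))"
      by (intro sum.cong) (auto simp: J_def)
    finally show ?thesis using log_eq[OF st] by simp
  qed
  have "\<exists>p. \<exists>\<epsilon>>0. \<forall>u. \<bar>u\<bar> \<le> \<epsilon> \<longrightarrow> \<psi> c0 u = poly p u"
  proof (rule ridge_sum_polynomial[where C = C and \<psi> = \<psi> and A = "\<lambda>s. \<Sum>j\<in>UNIV. f j (\<alpha> j * s)"
        and B = "\<lambda>t. (\<Sum>j\<in>UNIV. f j (\<beta> j * t)) - (\<Sum>j\<in>- J. f j (\<beta> j * t))", OF _ _ _ \<delta> ridge])
    show "finite C" "c0 \<in> C" "c0 \<noteq> 0" using l by (auto simp: C_def J_def c0_def)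
    show "continuous_on {-\<delta>..\<delta>} (\<psi> c0)"
      unfolding \<psi>_def f_def
    proof (intro continuous_on_sum continuous_on_ln continuous_on_norm ballI)
      fix j
      show "continuous_on {-\<delta>..\<delta>} (\<lambda>u. \<phi> j (\<alpha> j * u))"
        by (rule continuous_on_compose2[OF cont[of UNIV]]) (auto intro!: continuous_intros)
      show "norm (\<phi> j (\<alpha> j * u)) \<noteq> 0" if "u \<in> {-\<delta>..\<delta>}" for u
        using nz[of u 0 j] that \<delta> by (auto simp: abs_le_iff)
    qed
  qed
  then obtain p \<epsilon>0 where "\<epsilon>0 > 0" and p0: "\<And>u. \<bar>u\<bar> \<le> \<epsilon>0 \<Longrightarrow> \<psi> c0 u = poly p u" by blast
  define \<epsilon> where "\<epsilon> = min \<epsilon>0 \<delta>"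
  have \<epsilon>: "\<epsilon> > 0" "\<epsilon> \<le> \<delta>" and p: "\<And>u. \<bar>u\<bar> \<le> \<epsilon> \<Longrightarrow> \<psi> c0 u = poly p u"
    using \<open>\<epsilon>0 > 0\<close> \<delta> p0 by (auto simp: \<epsilon>_def)
  define J0 where "J0 = {j \<in> J. \<beta> j / \<alpha> j = c0}"
  have l_in: "l \<in> J0" using l by (auto simp: J0_def J_def c0_def)
  \<comment> \<open>\<open>G\<close> is the characteristic function of everything but one copy of \<open>\<alpha> l * Z l\<close> in the symmetrised sum over the group.\<close>
  define F where "F t = \<phi> l (\<alpha> l * t)" for t
  define G where "G t = cnj (\<phi> l (\<alpha> l * t)) * (\<Prod>j\<in>J0 - {l}. \<phi> j (\<alpha> j * t) * cnj (\<phi> j (\<alpha> j * t)))" for t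
  have "\<exists>a d::real. d \<ge> 0 \<and> (\<forall>t. F t = exp (\<i> * of_real (a * t) - of_real (d * t\<^sup>2)))"
  proof (rule factor_of_local_exp_poly)
    show "is_char F" unfolding F_def by (intro is_char_scale is_char)
    show "is_char G" unfolding G_def
      by (intro is_char_mult is_char_prod is_char_cnj is_char_scale is_char) simp
    show "\<epsilon> > 0" by fact
    fix t assume t: "\<bar>t\<bar> < \<epsilon>"
    have "F t * G t = (\<Prod>j\<in>J0. \<phi> j (\<alpha> j * t) * cnj (\<phi> j (\<alpha> j * t)))"
      using prod.remove[of J0 l "\<lambda>j. \<phi> j (\<alpha> j * t) * cnj (\<phi> j (\<alpha> j * t))"] l_in
      by (simp add: F_def G_def mult.assoc)
    also have "\<dots> = (\<Prod>j\<in>J0. of_real (exp (2 * f j (\<alpha> j * t))))"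
    proof (intro prod.cong refl)
      fix j
      have "\<phi> j (\<alpha> j * t) \<noteq> 0" using nz[of t 0 j] t \<epsilon> \<delta> by auto
      then have "exp (2 * f j (\<alpha> j * t)) = (norm (\<phi> j (\<alpha> j * t)))\<^sup>2"
        by (simp add: f_def exp_double)
      then show "\<phi> j (\<alpha> j * t) * cnj (\<phi> j (\<alpha> j * t)) = of_real (exp (2 * f j (\<alpha> j * t)))"
        by (metis complex_norm_square)
    qed
    also have "\<dots> = of_real (exp (2 * \<psi> c0 t))"
      unfolding \<psi>_def J0_def[symmetric] sum_distrib_left by (simp add: exp_sum)
    also have "\<dots> = exp (poly (map_poly of_real (smult 2 p)) (of_real t))"
      using p[of t] t by (simp add: exp_of_real[symmetric] poly_map_poly_of_real)
    finally show "F t * G t = exp (poly (map_poly of_real (smult 2 p)) (of_real t))" .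
  qed
  then obtain a d :: real where d: "d \<ge> 0" and F: "\<And>t. F t = exp (\<i> * of_real (a * t) - of_real (d * t\<^sup>2))"
    by blast
  have "\<phi> l t = exp (\<i> * of_real (a / \<alpha> l * t) - of_real (d / (\<alpha> l)\<^sup>2 * t\<^sup>2))" for t
    using F[of "t / \<alpha> l"] l by (simp add: F_def power_divide)
  then show ?thesis using d unfolding \<phi>_def by (intro exI[of _ "a / \<alpha> l"] exI[of _ "d / (\<alpha> l)\<^sup>2"]) auto
qed

lemma linear_phase_char_imp_return:
  assumes "real_distribution \<mu>" "\<And>t. char \<mu> t = exp (\<i> * of_real (a * t))"
  shows "\<mu> = return borel a"
  using assms by (intro Levy_uniqueness real_distribution_return) (auto simp: char_return mult_ac)

text \<open>If \<open>X'\<close> is an independent copy of \<open>X\<close>, then \<open>X - X'\<close> has characteristic function \<open>1 = exp 0\<close> near the origin, so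
the law of \<open>X\<close> has the form given by \<open>cramer_marcinkiewicz\<close>; a modulus of one leaves no
quadratic term.\<close>

lemma unimodular_char_imp_return:
  assumes \<mu>: "real_distribution \<mu>" and "\<epsilon> > 0" and mod: "\<And>t. \<bar>t\<bar> < \<epsilon> \<Longrightarrow> norm (char \<mu> t) = 1"
  shows "\<exists>c. \<mu> = return borel c"
proof -
  have "is_char (char \<mu>)" using \<mu> by (auto simp: is_char_def)
  then have "\<exists>a d::real. d \<ge> 0 \<and> (\<forall>t. char \<mu> t = exp (\<i> * of_real (a * t) - of_real (d * t\<^sup>2)))"
  proof (rule factor_of_local_exp_poly)
    show "is_char (\<lambda>t. cnj (char \<mu> t))" by (rule is_char_cnj) fact
    show "char \<mu> t * cnj (char \<mu> t) = exp (poly 0 (of_real t))" if "\<bar>t\<bar> < \<epsilon>" for t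
      using mod[OF that] complex_norm_square[of "char \<mu> t"] by simp
  qed fact
  then obtain a d :: real where c: "\<And>t. char \<mu> t = exp (\<i> * of_real (a * t) - of_real (d * t\<^sup>2))" by blast
  have "exp (- (d * (\<epsilon> / 2)\<^sup>2)) = 1"
    using mod[of "\<epsilon> / 2"] \<open>\<epsilon> > 0\<close> unfolding c by (simp del: of_real_mult of_real_power)
  then have "d = 0" using \<open>\<epsilon> > 0\<close> by simp
  then show ?thesis using linear_phase_char_imp_return[OF \<mu>, of a] c by auto
qed

text \<open>All factors but that of \<open>l\<close> cancel from the functional equation near the origin. Evaluating what is left
where \<open>\<alpha> l * s = u\<close> and \<open>\<beta> l * t = - u\<close> gives \<open>1 = \<phi> u * \<phi> (- u) = \<bar>\<phi> u\<bar>\<^sup>2\<close>.\<close>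

lemma single_common_summand_imp_return:
  fixes \<mu> :: "'k::finite \<Rightarrow> real measure" and \<alpha> \<beta> :: "'k \<Rightarrow> real"
  assumes rd: "\<And>j. real_distribution (\<mu> j)"
    and eq: "\<And>s t. (\<Prod>j\<in>UNIV. char (\<mu> j) (\<alpha> j * s + \<beta> j * t))
        = (\<Prod>j\<in>UNIV. char (\<mu> j) (\<alpha> j * s)) * (\<Prod>j\<in>UNIV. char (\<mu> j) (\<beta> j * t))"
    and l: "\<alpha> l \<noteq> 0" "\<beta> l \<noteq> 0" and others: "\<And>j. j \<noteq> l \<Longrightarrow> \<alpha> j = 0 \<or> \<beta> j = 0"
  shows "\<exists>c. \<mu> l = return borel c"
proof -
  obtain \<delta> where \<delta>: "\<delta> > 0"
    and nz: "\<And>j s t. \<bar>s\<bar> \<le> \<delta> \<Longrightarrow> \<bar>t\<bar> \<le> \<delta> \<Longrightarrow> char (\<mu> j) (\<alpha> j * s + \<beta> j * t) \<noteq> 0"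
    using chars_nonzero_near_0[where \<mu> = \<mu> and \<alpha> = \<alpha> and \<beta> = \<beta>, OF rd] by blast
  have z: "char (\<mu> j) 0 = 1" for j by (rule real_distribution.char_zero[OF rd])
  define \<epsilon> where "\<epsilon> = \<delta> * min \<bar>\<alpha> l\<bar> \<bar>\<beta> l\<bar>"
  have \<epsilon>: "\<epsilon> > 0" using \<delta> l by (simp add: \<epsilon>_def)
  have "norm (char (\<mu> l) u) = 1" if u: "\<bar>u\<bar> < \<epsilon>" for u
  proof -
    define s t where "s = u / \<alpha> l" and "t = - u / \<beta> l"
    have "\<epsilon> \<le> \<delta> * \<bar>\<alpha> l\<bar>" "\<epsilon> \<le> \<delta> * \<bar>\<beta> l\<bar>" using \<delta> by (auto simp: \<epsilon>_def)
    then have st: "\<bar>s\<bar> \<le> \<delta>" "\<bar>t\<bar> \<le> \<delta>" using u l by (auto simp: s_def t_def divide_simps)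
    let ?R = "\<Prod>j\<in>-{l}. char (\<mu> j) (\<alpha> j * s + \<beta> j * t)"
    have R: "?R \<noteq> 0" using nz[OF st] by simp
    have split: "(\<Prod>j\<in>UNIV. h j) = h l * (\<Prod>j\<in>-{l}. h j)" for h :: "'k \<Rightarrow> complex"
      using prod.remove[of UNIV l h] by (simp add: Compl_eq_Diff_UNIV)
    have "(\<Prod>j\<in>-{l}. char (\<mu> j) (\<alpha> j * s)) * (\<Prod>j\<in>-{l}. char (\<mu> j) (\<beta> j * t)) = ?R"
      unfolding prod.distrib[symmetric] using others z by (intro prod.cong) force+
    then have "?R = char (\<mu> l) u * char (\<mu> l) (- u) * ?R"
      using eq[of s t] l z[of l] unfolding split by (simp add: s_def t_def mult_ac)
    then have "char (\<mu> l) u * cnj (char (\<mu> l) u) = 1"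
      using R by (simp add: char_uminus)
    then have "(norm (char (\<mu> l) u))\<^sup>2 = 1"
      unfolding complex_norm_square[symmetric] by (metis of_real_eq_1_iff)
    then show ?thesis using norm_ge_zero[of "char (\<mu> l) u"] by (auto simp: power2_eq_1_iff)
  qed
  then show ?thesis using unimodular_char_imp_return[OF rd \<epsilon>] by blast
qed

section \<open>Independent components under a linear map\<close>

text \<open>After standardisation the characteristic function is that of the standard normal distribution, and characteristic
functions determine laws. The variance is \<open>2 d\<close>.\<close>

lemma (in prob_space) gaussian_of_char:
  assumes Y [measurable]: "random_variable borel Y" and "d > 0"
    and c: "\<And>t. char (distr M borel Y) t = exp (\<i> * of_real (a * t) - of_real (d * t\<^sup>2))"
  shows "gaussian M Y"
proof -
  define \<sigma> where "\<sigma> = sqrt (2 * d)"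
  have \<sigma>: "\<sigma> > 0" "\<sigma>\<^sup>2 = 2 * d" using \<open>d > 0\<close> by (auto simp: \<sigma>_def)
  let ?W = "\<lambda>\<omega>. (Y \<omega> - a) / \<sigma>"
  have "distr M borel ?W = std_normal_distribution"
  proof (rule Levy_uniqueness)
    show "real_distribution (distr M borel ?W)" by (intro real_distribution_distr) simp
    show "real_distribution std_normal_distribution" by (rule real_dist_normal_dist)
    show "char (distr M borel ?W) = char std_normal_distribution"
    proof
      fix t
      have "char (distr M borel ?W) t = (CLINT \<omega>|M. iexp (- (a * t / \<sigma>)) * iexp (t / \<sigma> * Y \<omega>))"
        by (simp add: char_def integral_distr diff_divide_distrib algebra_simps flip: exp_add)
      also have "\<dots> = iexp (- (a * t / \<sigma>)) * char (distr M borel Y) (t / \<sigma>)"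
        by (simp add: char_def integral_distr)
      also have "\<dots> = exp (- of_real (d * (t / \<sigma>)\<^sup>2))"
        unfolding c by (simp flip: exp_add)
      also have "d * (t / \<sigma>)\<^sup>2 = t\<^sup>2 / 2" using \<sigma> \<open>d > 0\<close> by (simp add: power_divide)
      finally show "char (distr M borel ?W) t = char std_normal_distribution t"
        unfolding char_std_normal_distribution by (simp flip: exp_of_real)
    qed
  qed
  moreover have "distr M lborel ?W = distr M borel ?W" by (rule distr_cong) auto
  ultimately have "distributed M lborel ?W std_normal_density"
    by (simp add: distributed_def)
  then have "distributed M lborel Y (normal_density a \<sigma>)"
    using normal_standard_normal_convert[OF \<sigma>(1)] by simp
  then show ?thesis using \<sigma>(1) by (auto simp: gaussian_def)
qed

lemma (in prob_space) gaussian_of_nonconstant_char: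
  assumes Y [measurable]: "random_variable borel Y" and "as_nonconstant M Y" and "d \<ge> 0"
    and c: "\<And>t. char (distr M borel Y) t = exp (\<i> * of_real (a * t) - of_real (d * t\<^sup>2))"
  shows "gaussian M Y"
proof (cases "d = 0")
  case True
  have "distr M borel Y = return borel a"
    using c True by (intro linear_phase_char_imp_return real_distribution_distr) auto
  then show ?thesis using assms by (auto simp: as_nonconstant_def)
next
  case False
  then show ?thesis using gaussian_of_char[OF Y _ c] \<open>d \<ge> 0\<close> by simp
qed

lemma (in prob_space) char_linear_combination:
  fixes Z :: "'k::finite \<Rightarrow> 'a \<Rightarrow> real"
  assumes "indep_vars (\<lambda>_. borel) Z UNIV"
  shows "char (distr M borel (\<lambda>\<omega>. \<Sum>j\<in>UNIV. c j * Z j \<omega>)) 1 = (\<Prod>j\<in>UNIV. char (distr M borel (Z j)) (c j))"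
proof -
  have [measurable]: "random_variable borel (Z j)" for j
    using assms by (auto simp: indep_vars_def)
  have "indep_vars (\<lambda>_. borel) (\<lambda>j \<omega>. c j * Z j \<omega>) UNIV"
    by (rule indep_vars_compose2[OF assms]) simp
  then have "char (distr M borel (\<lambda>\<omega>. \<Sum>j\<in>UNIV. c j * Z j \<omega>)) 1
      = (\<Prod>j\<in>UNIV. char (distr M borel (\<lambda>\<omega>. c j * Z j \<omega>)) 1)"
    by (rule char_distr_sum)
  also have "\<dots> = (\<Prod>j\<in>UNIV. char (distr M borel (Z j)) (c j))"
    by (intro prod.cong) (simp_all add: char_def integral_distr)
  finally show ?thesis .
qed

text \<open>The only joint information needed about \<open>W\<close> is the characteristic function of \<open>s * W\<^sub>a + t * W\<^sub>b\<close>,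
computed once from the components of \<open>W\<close> and once from those of \<open>Z\<close>. By \<open>darmois_skitovich\<close> every index shared by the rows \<open>a\<close> and \<open>b\<close>
belongs to a Gaussian component, so \<open>l\<close> is the only shared index, and then \<open>Z\<^sub>l\<close> would be constant.\<close>

theorem (in prob_space) independent_mixing_columns:
  fixes Z W :: "'a \<Rightarrow> real^'k" and B :: "real^'k^'k"
  assumes Zm [measurable]: "random_variable borel Z" and Wm [measurable]: "random_variable borel W"
    and WZ: "AE \<omega> in M. W \<omega> = B *v Z \<omega>"
    and Z: "indep_vars (\<lambda>_. borel) (\<lambda>j \<omega>. Z \<omega> $ j) UNIV"
    and W: "indep_vars (\<lambda>_. borel) (\<lambda>j \<omega>. W \<omega> $ j) UNIV"
    and nonconst: "\<And>j. as_nonconstant M (\<lambda>\<omega>. Z \<omega> $ j)"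
    and gauss: "card {j. gaussian M (\<lambda>\<omega>. Z \<omega> $ j)} \<le> 1"
    and ab: "B $ a $ l \<noteq> 0" "B $ b $ l \<noteq> 0"
  shows "a = b"
proof (rule ccontr)
  assume "a \<noteq> b"
  define \<mu> where "\<mu> j = distr M borel (\<lambda>\<omega>. Z \<omega> $ j)" for j
  define \<nu> where "\<nu> j = distr M borel (\<lambda>\<omega>. W \<omega> $ j)" for j
  have comp [measurable]: "(\<lambda>\<omega>. Z \<omega> $ j) \<in> borel_measurable M" "(\<lambda>\<omega>. W \<omega> $ j) \<in> borel_measurable M" for j
    using Z W by (auto simp: indep_vars_def)
  have rd: "real_distribution (\<mu> j)" and rd': "real_distribution (\<nu> j)" for j
    unfolding \<mu>_def \<nu>_def by (intro real_distribution_distr; simp)+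
  have z: "char (\<mu> j) 0 = 1" "char (\<nu> j) 0 = 1" for j
    by (rule real_distribution.char_zero[OF rd]) (rule real_distribution.char_zero[OF rd'])
  have joint: "(\<Prod>j\<in>UNIV. char (\<mu> j) (B $ a $ j * s + B $ b $ j * t)) = char (\<nu> a) s * char (\<nu> b) t" for s t
  proof -
    define c where "c i = (if i = a then s else if i = b then t else 0)" for i
    have c_sum: "(\<Sum>i\<in>UNIV. c i * g i) = s * g a + t * g b" for g :: "'k \<Rightarrow> real"
    proof -
      have "(\<Sum>i\<in>UNIV. c i * g i) = (\<Sum>i\<in>{a, b}. c i * g i)"
        by (intro sum.mono_neutral_right) (auto simp: c_def)
      then show ?thesis using \<open>a \<noteq> b\<close> by (simp add: c_def)
    qed
    have "char (\<nu> a) s * char (\<nu> b) t = (\<Prod>i\<in>{a, b}. char (\<nu> i) (c i))"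
      using \<open>a \<noteq> b\<close> by (simp add: c_def)
    also have "\<dots> = (\<Prod>i\<in>UNIV. char (\<nu> i) (c i))"
      by (intro prod.mono_neutral_left) (auto simp: c_def z)
    also have "\<dots> = char (distr M borel (\<lambda>\<omega>. \<Sum>i\<in>UNIV. c i * W \<omega> $ i)) 1"
      unfolding \<nu>_def by (rule char_linear_combination[OF W, symmetric])
    also have "distr M borel (\<lambda>\<omega>. \<Sum>i\<in>UNIV. c i * W \<omega> $ i)
        = distr M borel (\<lambda>\<omega>. \<Sum>j\<in>UNIV. (B $ a $ j * s + B $ b $ j * t) * Z \<omega> $ j)"
    proof (rule distr_cong_AE)
      show "AE \<omega> in M. (\<Sum>i\<in>UNIV. c i * W \<omega> $ i) = (\<Sum>j\<in>UNIV. (B $ a $ j * s + B $ b $ j * t) * Z \<omega> $ j)"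
        using WZ
      proof eventually_elim
        case (elim \<omega>)
        show ?case unfolding c_sum elim
          by (simp add: matrix_vector_mult_def sum_distrib_left distrib_left distrib_right sum.distrib mult_ac)
      qed
    qed measurable
    also have "char \<dots> 1 = (\<Prod>j\<in>UNIV. char (\<mu> j) (B $ a $ j * s + B $ b $ j * t))"
      unfolding \<mu>_def by (rule char_linear_combination[OF Z])
    finally show ?thesis ..
  qed
  have eq: "(\<Prod>j\<in>UNIV. char (\<mu> j) (B $ a $ j * s + B $ b $ j * t))
      = (\<Prod>j\<in>UNIV. char (\<mu> j) (B $ a $ j * s)) * (\<Prod>j\<in>UNIV. char (\<mu> j) (B $ b $ j * t))" for s t
    using joint[of s t] joint[of s 0] joint[of 0 t] by (simp add: z)
  have common_gaussian: "gaussian M (\<lambda>\<omega>. Z \<omega> $ j)" if "B $ a $ j \<noteq> 0" "B $ b $ j \<noteq> 0" for j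
    using darmois_skitovich[OF rd eq that] gaussian_of_nonconstant_char[OF comp(1) nonconst, of _ j]
    unfolding \<mu>_def by blast
  have "B $ a $ j = 0 \<or> B $ b $ j = 0" if "j \<noteq> l" for j
  proof (rule ccontr)
    assume "\<not> ?thesis"
    then have "{j, l} \<subseteq> {j. gaussian M (\<lambda>\<omega>. Z \<omega> $ j)}" using common_gaussian ab by auto
    then have "card {j, l} \<le> 1" using gauss by (meson card_mono finite order_trans)
    then show False using that by simp
  qed
  then obtain c where "\<mu> l = return borel c"
    using single_common_summand_imp_return[OF rd eq ab] by blast
  then show False using nonconst[of l] by (auto simp: as_nonconstant_def \<mu>_def)
qed

section \<open>Acyclic matrices and the theorem\<close>

text \<open>A fixed vector of \<open>\<Theta>\<close> vanishes in every coordinate, by induction along the causal order: each coordinate is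
a combination of strictly earlier ones.\<close>

lemma acyclic_invertible:
  fixes \<Theta> :: "real^'k^'k"
  assumes "acyclic_matrix \<Theta>"
  shows "\<exists>E. E ** (mat 1 - \<Theta>) = mat 1"
  unfolding matrix_left_invertible_ker
proof (intro allI impI)
  fix x :: "real^'k" assume "(mat 1 - \<Theta>) *v x = 0"
  then have x: "\<Theta> *v x = x" by (simp add: matrix_vector_mult_diff_rdistrib)
  obtain \<pi> where \<pi>: "\<And>a b. \<pi> a \<le> (\<pi> b :: nat) \<Longrightarrow> \<Theta> $ a $ b = 0"
    using assms by (auto simp: acyclic_matrix_def causal_order_def)
  have "x $ a = 0" for a
  proof (induction "\<pi> a" arbitrary: a rule: less_induct)
    case less
    have z: "\<Theta> $ a $ b * x $ b = 0" for b
      using less[of b] \<pi>[of a b] by (cases "\<pi> b < \<pi> a") auto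
    have "(\<Theta> *v x) $ a = 0"
      unfolding matrix_vector_mult_def vec_lambda_beta by (rule sum.neutral) (use z in blast)
    then show ?case by (simp add: x)
  qed
  then show "x = 0" by (simp add: vec_eq_iff)
qed

text \<open>Choosing in each row of \<open>B\<close> a nonzero entry defines an injection \<open>\<sigma>\<close> because no column has two of them; on a
finite index set it is a permutation, and \<open>B\<close> has no further nonzero entries. The entry \<open>(\<sigma> i, i)\<close> of
\<open>I - \<Theta>1\<close> is nonzero since the diagonal of \<open>I - \<Theta>2\<close> is, and therefore \<open>\<pi> i \<le> \<pi> (\<sigma> i)\<close>. Both
sides have the same sum over \<open>i\<close>, so they are equal.\<close>

lemma acyclic_row_permutation_eq:
  fixes \<Theta>1 \<Theta>2 B :: "real^'k^'k"
  assumes ac1: "acyclic_matrix \<Theta>1" and ac2: "acyclic_matrix \<Theta>2"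
    and B: "mat 1 - \<Theta>2 = B ** (mat 1 - \<Theta>1)"
    and cols: "\<And>a b l. B $ a $ l \<noteq> 0 \<Longrightarrow> B $ b $ l \<noteq> 0 \<Longrightarrow> a = b"
  shows "\<Theta>1 = \<Theta>2"
proof -
  have diag: "(mat 1 - \<Theta>) $ i $ i = 1" if "acyclic_matrix \<Theta>" for \<Theta> :: "real^'k^'k" and i
    using that by (auto simp: acyclic_matrix_def causal_order_def mat_def)
  have ent: "(mat 1 - \<Theta>2) $ i $ j = (\<Sum>l\<in>UNIV. B $ i $ l * (mat 1 - \<Theta>1) $ l $ j)" for i j
    unfolding B by (simp add: matrix_matrix_mult_def)
  have "\<exists>l. B $ i $ l \<noteq> 0" for i
  proof (rule ccontr)
    assume "\<not> ?thesis"
    then have "(mat 1 - \<Theta>2) $ i $ i = 0" unfolding ent by simp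
    then show False using diag[OF ac2, of i] by simp
  qed
  then obtain \<sigma> where \<sigma>: "\<And>i. B $ i $ \<sigma> i \<noteq> 0" by metis
  have "inj \<sigma>" using \<sigma> cols by (intro injI) metis
  then have surj: "surj \<sigma>" by (simp add: finite_UNIV_inj_surj)
  have ent': "(mat 1 - \<Theta>2) $ i $ j = B $ i $ \<sigma> i * (mat 1 - \<Theta>1) $ \<sigma> i $ j" for i j
  proof -
    have "B $ i $ l = 0" if "l \<noteq> \<sigma> i" for l
      using that surj \<sigma> cols by (metis surjD)
    then have "(\<Sum>l\<in>UNIV. B $ i $ l * (mat 1 - \<Theta>1) $ l $ j) = (\<Sum>l\<in>{\<sigma> i}. B $ i $ l * (mat 1 - \<Theta>1) $ l $ j)"
      by (intro sum.mono_neutral_right) auto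
    then show ?thesis unfolding ent by simp
  qed
  obtain \<pi> where bij: "bij_betw \<pi> UNIV {1..CARD('k)}" and \<pi>: "\<And>a b. \<pi> a \<le> \<pi> b \<Longrightarrow> \<Theta>1 $ a $ b = 0"
    using ac1 by (auto simp: acyclic_matrix_def causal_order_def)
  have le: "\<pi> i \<le> \<pi> (\<sigma> i)" for i
  proof (rule ccontr)
    assume "\<not> ?thesis"
    then have "\<Theta>1 $ \<sigma> i $ i = 0" "\<sigma> i \<noteq> i" using \<pi>[of "\<sigma> i" i] by auto
    then have "(mat 1 - \<Theta>2) $ i $ i = 0" unfolding ent' by (simp add: mat_def)
    then show False using diag[OF ac2, of i] by simp
  qed
  have sum_eq: "(\<Sum>i\<in>UNIV. \<pi> (\<sigma> i)) = (\<Sum>i\<in>UNIV. \<pi> i)"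
    using sum.reindex_bij_betw[of \<sigma> UNIV UNIV \<pi>] \<open>inj \<sigma>\<close> surj by (simp add: bij_betw_def)
  have "\<pi> (\<sigma> i) = \<pi> i" for i
  proof (rule ccontr)
    assume "\<pi> (\<sigma> i) \<noteq> \<pi> i"
    then have "\<pi> i < \<pi> (\<sigma> i)" using le[of i] by simp
    then have "(\<Sum>i\<in>UNIV. \<pi> i) < (\<Sum>i\<in>UNIV. \<pi> (\<sigma> i))"
      using le by (intro sum_strict_mono_ex1) auto
    then show False using sum_eq by simp
  qed
  then have \<sigma>_id: "\<sigma> i = i" for i using bij by (meson UNIV_I bij_betw_def inj_onD)
  have "B $ i $ i = 1" for i
    using ent'[of i i] diag[OF ac2, of i] diag[OF ac1, of i] by (simp add: \<sigma>_id)
  then have "(mat 1 - \<Theta>2) $ i $ j = (mat 1 - \<Theta>1) $ i $ j" for i j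
    using ent'[of i j] by (simp add: \<sigma>_id)
  then show ?thesis by (simp add: vec_eq_iff)
qed

theorem corollary7p32:
  fixes M :: "'a measure"
    and X Z1 Z2 :: "'a \<Rightarrow> real^'k"
    and \<Theta>1 \<Theta>2 :: "real^'k^'k"
  assumes "prob_space M"
    and "lingam M X \<Theta>1 Z1"
    and "lingam M X \<Theta>2 Z2"
  shows "\<Theta>1 = \<Theta>2 \<and> (AE \<omega> in M. Z1 \<omega> = Z2 \<omega>)"
proof -
  interpret prob_space M by fact
  note L1 = assms(2)[unfolded lingam_def] and L2 = assms(3)[unfolded lingam_def]
  obtain E where E: "E ** (mat 1 - \<Theta>1) = mat 1"
    using acyclic_invertible L1 by blast
  define B where "B = (mat 1 - \<Theta>2) ** E"
  have B: "mat 1 - \<Theta>2 = B ** (mat 1 - \<Theta>1)"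
    by (simp add: B_def E flip: matrix_mul_assoc)
  have Z1: "AE \<omega> in M. Z1 \<omega> = (mat 1 - \<Theta>1) *v X \<omega>"
    using L1 by (auto simp: matrix_vector_mult_diff_rdistrib algebra_simps elim!: eventually_mono)
  have Z2: "AE \<omega> in M. Z2 \<omega> = (mat 1 - \<Theta>2) *v X \<omega>"
    using L2 by (auto simp: matrix_vector_mult_diff_rdistrib algebra_simps elim!: eventually_mono)
  have "AE \<omega> in M. Z2 \<omega> = B *v Z1 \<omega>"
    using Z1 Z2 by eventually_elim (simp add: B matrix_vector_mul_assoc)
  then have "a = b" if "B $ a $ l \<noteq> 0" "B $ b $ l \<noteq> 0" for a b l
    using independent_mixing_columns[of Z1 Z2 B a l b] L1 L2 that by blast
  then have "\<Theta>1 = \<Theta>2"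
    using acyclic_row_permutation_eq[OF _ _ B] L1 L2 by blast
  moreover have "AE \<omega> in M. Z1 \<omega> = Z2 \<omega>"
    using Z1 Z2 by eventually_elim (simp add: \<open>\<Theta>1 = \<Theta>2\<close>)
  ultimately show ?thesis ..
qed

end
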